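(* Let $\Gamma$ be a connected weighted graph satisfying the Sunada-Sy condition. Let $G$ be a group acting on $\Gamma$ (no freeness hypothesis is made). Assume the weights $m_V$ and $m_E$ are $G$-invariant. Let $H=\Delta+q$ be a Schrödinger operator on $\Gamma$ defined by a real valued $G$-invariant potential $q$. Suppose the action of $G$ on the vertex set $V$ of $\Gamma$ has a finite number of orbits. Let $\mathcal{F}$ be the family of all fundamental domains for the action of $G$ on $V$. Let $\Omega\subset V$ be a finite subset. Assume the packing number $P(\Omega,\mathcal{F})$ of $\Omega$ with respect to the family $\mathcal{F}$ is nonzero; in other words, $\Omega$ contains as a subset at least one fundamental domain. Let $\lambda\in\mathbb{R}$. Let $E_{\{\lambda\}}$ be the spectral projection onto the $\lambda$-eigenspace of $H$. If $H$ satisfies $\lambda$-uniqueness on $\Omega$ then $$\tau\left(E_{\{\lambda\}}\right)\le\frac{|\partial_2\Omega|}{P(\Omega,\mathcal{F})}.$$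
   Context: Graph (Serre): $\Gamma=(V,E,o,t,\iota)$ with vertex set $V$, set $E$ of oriented edges, origin and terminus maps $o,t:E\to V$, and a fixed point free involution $\iota(e)=\overline{e}$ of $E$ with $o(\overline e)=t(e)$, $t(\overline e)=o(e)$. Loops and multiple edges are allowed; the definition does not imply local finiteness. $E_x=\{e\in E:o(e)=x\}$. $\Gamma$ is connected if any two vertices are joined by a finite edge path; the path-metric $d(x,y)$ is the minimal length of a path from $x$ to $y$. Weighted graph: strictly positive weights $m_V:V\to\,]0,\infty[$ and $m_E:E\to\,]0,\infty[$ with $m_E(\overline e)=m_E(e)$. $l^2(V,m_V)$ is the Hilbert space of $\varphi:V\to\mathbb{C}$ with $\sum_x|\varphi(x)|^2m_V(x)<\infty$, with product $\langle\varphi,\psi\rangle=\sum_x\varphi(x)\overline{\psi(x)}m_V(x)$. Sunada-Sy condition: $\sup_{x\in V}\frac{1}{m_V(x)}\sum_{e\in E_x}m_E(e)<\infty$. Laplacian: the bounded operator on $l^2(V,m_V)$ given by $\Delta\varphi(x)=\left(\frac{1}{m_V(x)}\sum_{e\in E_x}m_E(e)\right)\varphi(x)-\frac{1}{m_V(x)}\sum_{e\in E_x}\varphi(t(e))m_E(e)$. Schrödinger operator: $H=\Delta+q$ with potential $q:V\to\mathbb{R}$ bounded, acting by $H\varphi(x)=\Delta\varphi(x)+q(x)\varphi(x)$; it is bounded and self-adjoint. $E_{\{\lambda\}}$ is the orthogonal projection onto $\{\varphi\in l^2(V,m_V):H\varphi=\lambda\varphi\}$. $\lambda$-uniqueness (also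 called $\lambda$-unicity) of $H$ on $\Omega\subset V$: if $\varphi\in l^2(V,m_V)$ satisfies $H\varphi=\lambda\varphi$ and $\varphi(x)=0$ for all $x\in V\setminus\Omega$, then $\varphi(x)=0$ for all $x\in V$. Thick boundary: $\partial_r\Omega=\{x\in\Omega:d(x,V\setminus\Omega)\le r\}$, where $d(x,A)=\inf_{y\in A}d(x,y)$. $|\cdot|$ denotes cardinality. Group action on $\Gamma$: $G$ acts on the left on $V$ and on $E$ with $o(ge)=go(e)$, $t(ge)=gt(e)$, $\iota(ge)=g\iota(e)$. Invariance of weights and potential: $m_V(gx)=m_V(x)$, $m_E(ge)=m_E(e)$, $q(gx)=q(x)$ for all $g\in G$, $x\in V$, $e\in E$. A fundamental domain is a subset $D\subset V$ with $V=\bigsqcup_{x\in D}Gx$ (exactly one vertex from each orbit). Packing number: for a family $\mathcal{F}$ of non-empty subsets of $V$, $P(\Omega,\mathcal{F})$ is the maximal number of pairwise disjoint elements of $\mathcal{F}$ included in $\Omega$ (zero if no element of $\mathcal{F}$ is included in $\Omega$). Trace: for a positive bounded operator $A$ on $l^2(V,m_V)$ commuting with the unitary representation $(\pi(g)f)(x)=f(g^{-1}x)$ of $G$, $\tau(A)=\sum_{x\in D}\langle A\delta_x,\delta_x\rangle$, where $D$ is a fundamental domain (the value does not depend on the choice of $D$) and $\delta_x$ is the characteristic function of the singleton $\{x\}$.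
   Formalization: The trace is normalized as the sum over D of ⟨Aδ_x,δ_x⟩/m_V(x), i.e. along unit vectors; with δ_x the bare characteristic function the bound fails, since scaling m_V and m_E by c scales τ by c but changes nothing else. *)

theory Defs
  imports
    "HOL-Analysis.Elementary_Metric_Spaces"
    "HOL-Analysis.Infinite_Sum"
    "HOL-Library.Extended_Nat"
    "HOL-Library.Disjoint_Sets"
    "HOL-Library.Indicator_Function"
    "HOL-Algebra.Group_Action"
    "Graph_Theory.Bidirected_Digraph"
    "Graph_Theory.Digraph_Component"
begin

section \<open>Weighted graphs\<close>

text \<open>
  A graph in the sense of Serre is a \<^locale>\<open>bidirected_digraph\<close>: the arcs are the oriented edges,
  \<^const>\<open>tail\<close> is the origin, \<^const>\<open>head\<close> is the terminus, and \<open>arev\<close> is the fixed point free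
  involution of the arcs (by the library's convention it is the identity outside the arcs).
\<close>

locale weighted_graph = bidirected_digraph \<Gamma> arev
  for \<Gamma> :: "('v, 'e) pre_digraph" and arev :: "'e \<Rightarrow> 'e" +
  fixes mV :: "'v \<Rightarrow> real" and mE :: "'e \<Rightarrow> real"
  assumes mV_pos: "x \<in> verts \<Gamma> \<Longrightarrow> 0 < mV x"
    and mE_pos: "e \<in> arcs \<Gamma> \<Longrightarrow> 0 < mE e"
    and mE_arev: "e \<in> arcs \<Gamma> \<Longrightarrow> mE (arev e) = mE e"

text \<open>
  Summability is required separately, since \<^const>\<open>infsum\<close> of a divergent real family is \<open>0\<close>.
\<close>

definition sunada_sy :: "('v, 'e) pre_digraph \<Rightarrow> ('v \<Rightarrow> real) \<Rightarrow> ('e \<Rightarrow> real) \<Rightarrow> bool" where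
  "sunada_sy \<Gamma> mV mE \<longleftrightarrow>
     (\<forall>x\<in>verts \<Gamma>. mE summable_on out_arcs \<Gamma> x) \<and>
     bdd_above ((\<lambda>x. 1 / mV x * (\<Sum>\<^sub>\<infinity>e\<in>out_arcs \<Gamma> x. mE e)) ` verts \<Gamma>)"

definition path_dist :: "('v, 'e) pre_digraph \<Rightarrow> 'v \<Rightarrow> 'v \<Rightarrow> enat" where
  "path_dist \<Gamma> x y = (INF p\<in>{p. pre_digraph.awalk \<Gamma> x p y}. enat (length p))"

text \<open>The distance to the empty set is \<open>\<infinity>\<close>, so the whole vertex set has empty boundary.\<close>

definition thick_boundary :: "('v, 'e) pre_digraph \<Rightarrow> nat \<Rightarrow> 'v set \<Rightarrow> 'v set" where
  "thick_boundary \<Gamma> r \<Omega> = {x \<in> \<Omega>. (INF y\<in>verts \<Gamma> - \<Omega>. path_dist \<Gamma> x y) \<le> enat r}"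


section \<open>The Hilbert space and the Schroedinger operator\<close>

text \<open>
  A complex function on the vertex set is represented by its extension by zero to the whole type,
  so that equality on the vertex set is equality of functions.
\<close>

definition l2 :: "'v set \<Rightarrow> ('v \<Rightarrow> real) \<Rightarrow> ('v \<Rightarrow> complex) set" where
  "l2 V m = {\<phi>. (\<forall>x. x \<notin> V \<longrightarrow> \<phi> x = 0) \<and> (\<lambda>x. (cmod (\<phi> x))\<^sup>2 * m x) summable_on V}"

definition l2_inner :: "'v set \<Rightarrow> ('v \<Rightarrow> real) \<Rightarrow> ('v \<Rightarrow> complex) \<Rightarrow> ('v \<Rightarrow> complex) \<Rightarrow> complex" where
  "l2_inner V m \<phi> \<psi> = (\<Sum>\<^sub>\<infinity>x\<in>V. \<phi> x * cnj (\<psi> x) * of_real (m x))"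

definition laplacian ::
  "('v, 'e) pre_digraph \<Rightarrow> ('v \<Rightarrow> real) \<Rightarrow> ('e \<Rightarrow> real) \<Rightarrow> ('v \<Rightarrow> complex) \<Rightarrow> 'v \<Rightarrow> complex" where
  "laplacian \<Gamma> mV mE \<phi> = (\<lambda>x. if x \<in> verts \<Gamma> then
       of_real (1 / mV x * (\<Sum>\<^sub>\<infinity>e\<in>out_arcs \<Gamma> x. mE e)) * \<phi> x
       - of_real (1 / mV x) * (\<Sum>\<^sub>\<infinity>e\<in>out_arcs \<Gamma> x. \<phi> (head \<Gamma> e) * of_real (mE e))
     else 0)"

definition schroedinger ::
  "('v, 'e) pre_digraph \<Rightarrow> ('v \<Rightarrow> real) \<Rightarrow> ('e \<Rightarrow> real) \<Rightarrow> ('v \<Rightarrow> real) \<Rightarrow>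
    ('v \<Rightarrow> complex) \<Rightarrow> 'v \<Rightarrow> complex" where
  "schroedinger \<Gamma> mV mE q \<phi> = (\<lambda>x. laplacian \<Gamma> mV mE \<phi> x + of_real (q x) * \<phi> x)"

definition eigenspace ::
  "'v set \<Rightarrow> ('v \<Rightarrow> real) \<Rightarrow> (('v \<Rightarrow> complex) \<Rightarrow> 'v \<Rightarrow> complex) \<Rightarrow> real \<Rightarrow> ('v \<Rightarrow> complex) set" where
  "eigenspace V m A lam = {\<phi> \<in> l2 V m. \<forall>x\<in>V. A \<phi> x = of_real lam * \<phi> x}"

definition lambda_unique ::
  "'v set \<Rightarrow> ('v \<Rightarrow> real) \<Rightarrow> (('v \<Rightarrow> complex) \<Rightarrow> 'v \<Rightarrow> complex) \<Rightarrow> real \<Rightarrow> 'v set \<Rightarrow> bool" where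
  "lambda_unique V m A lam \<Omega> \<longleftrightarrow>
     (\<forall>\<phi>\<in>l2 V m. (\<forall>x\<in>V. A \<phi> x = of_real lam * \<phi> x) \<and> (\<forall>x\<in>V - \<Omega>. \<phi> x = 0)
        \<longrightarrow> (\<forall>x\<in>V. \<phi> x = 0))"

text \<open>
  Orthogonal projection onto a closed subspace \<open>S\<close> of \<^term>\<open>l2 V m\<close>; only meaningful at
  arguments in \<^term>\<open>l2 V m\<close>.
\<close>

definition orth_proj ::
  "'v set \<Rightarrow> ('v \<Rightarrow> real) \<Rightarrow> ('v \<Rightarrow> complex) set \<Rightarrow> ('v \<Rightarrow> complex) \<Rightarrow> 'v \<Rightarrow> complex" where
  "orth_proj V m S f = (THE g. g \<in> S \<and> (\<forall>h\<in>S. l2_inner V m (\<lambda>x. f x - g x) h = 0))"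

abbreviation spectral_proj ::
  "'v set \<Rightarrow> ('v \<Rightarrow> real) \<Rightarrow> (('v \<Rightarrow> complex) \<Rightarrow> 'v \<Rightarrow> complex) \<Rightarrow> real \<Rightarrow>
    ('v \<Rightarrow> complex) \<Rightarrow> 'v \<Rightarrow> complex" where
  "spectral_proj V m A lam \<equiv> orth_proj V m (eigenspace V m A lam)"


section \<open>Group actions on graphs\<close>

locale graph_action =
  vertex_action: group_action G "verts \<Gamma>" \<alpha> + edge_action: group_action G "arcs \<Gamma>" \<beta>
  for G :: "('g, 'c) monoid_scheme" (structure)
    and \<Gamma> :: "('v, 'e) pre_digraph" and arev :: "'e \<Rightarrow> 'e"
    and \<alpha> :: "'g \<Rightarrow> 'v \<Rightarrow> 'v" and \<beta> :: "'g \<Rightarrow> 'e \<Rightarrow> 'e" +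
  assumes tail_act: "\<lbrakk>g \<in> carrier G; e \<in> arcs \<Gamma>\<rbrakk> \<Longrightarrow> tail \<Gamma> (\<beta> g e) = \<alpha> g (tail \<Gamma> e)"
    and head_act: "\<lbrakk>g \<in> carrier G; e \<in> arcs \<Gamma>\<rbrakk> \<Longrightarrow> head \<Gamma> (\<beta> g e) = \<alpha> g (head \<Gamma> e)"
    and arev_act: "\<lbrakk>g \<in> carrier G; e \<in> arcs \<Gamma>\<rbrakk> \<Longrightarrow> arev (\<beta> g e) = \<beta> g (arev e)"

definition fundamental_domain ::
  "('g, 'c) monoid_scheme \<Rightarrow> 'v set \<Rightarrow> ('g \<Rightarrow> 'v \<Rightarrow> 'v) \<Rightarrow> 'v set \<Rightarrow> bool" where
  "fundamental_domain G V \<alpha> D \<longleftrightarrow>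
     D \<subseteq> V \<and> (\<Union>x\<in>D. Group_Action.orbit G \<alpha> x) = V \<and>
     disjoint_family_on (Group_Action.orbit G \<alpha>) D"

text \<open>Used for finite \<open>\<Omega>\<close> only, where the maximum is over a finite set containing \<open>0\<close>.\<close>

definition packing_number :: "'v set \<Rightarrow> 'v set set \<Rightarrow> nat" where
  "packing_number \<Omega> \<F> = Max {card \<C> | \<C>. \<C> \<subseteq> \<F> \<and> disjoint \<C> \<and> (\<forall>A\<in>\<C>. A \<subseteq> \<Omega>)}"

text \<open>
  The trace of a positive operator \<open>A\<close> commuting with the group, computed on a fundamental domain
  \<open>D\<close>. The characteristic function of \<open>{x}\<close> has squared norm \<open>m x\<close>, and each term is divided by
  it, so that the trace is taken along orthonormal vectors. Without this normalisation the trace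
  would be multiplied by \<open>c\<close> when both weights are multiplied by \<open>c\<close>, although the operator
  and its spectral projections do not change, and no bound by numbers of vertices could hold. The
  two expressions agree for \<open>m = 1\<close>. The diagonal terms of a positive operator are real.
\<close>

definition trace_on ::
  "'v set \<Rightarrow> ('v \<Rightarrow> real) \<Rightarrow> 'v set \<Rightarrow> (('v \<Rightarrow> complex) \<Rightarrow> 'v \<Rightarrow> complex) \<Rightarrow> real" where
  "trace_on V m D A =
     (\<Sum>\<^sub>\<infinity>x\<in>D. Re (l2_inner V m (A (indicator {x})) (indicator {x})) / m x)"

end

theory Submission
  imports Defs
begin

text \<open>
  Let \<open>P\<close> be the orthogonal projection onto the \<open>\<lambda>\<close>-eigenspace \<open>S\<close> of \<open>H\<close> and put
  \<open>k\<^sub>x = P \<delta>\<^sub>x\<close>. Up to the weight, \<open>k\<^sub>x\<close> is the reproducing kernel of \<open>S\<close>: pairing an eigenfunction with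
  it gives the value at \<open>x\<close>. The trace on a fundamental domain is therefore the sum of the
  diagonal values \<open>k\<^sub>x(x)\<close>, which are nonnegative, and which depend only on the orbit of \<open>x\<close>
  because \<open>H\<close> commutes with the group (\<open>kernel_invariant\<close>).

  If \<open>\<Omega>\<close> contains \<open>N\<close> disjoint fundamental domains, then \<open>N\<close> times the trace is a sum of diagonal
  values over distinct points of \<open>\<Omega>\<close>, hence at most the sum over all of \<open>\<Omega>\<close>. That sum is the
  trace of the compression of \<open>P\<close> to \<open>\<Omega>\<close>, an operator between \<open>0\<close> and \<open>1\<close>, so it is at most
  its rank, which is the dimension of the space of restrictions to \<open>\<Omega>\<close> of eigenfunctions.

  This dimension is at most \<open>|\<partial>\<^sub>2\<Omega>|\<close>, because an eigenfunction \<open>\<phi>\<close> that vanishes on \<open>\<partial>\<^sub>2\<Omega>\<close> vanishes on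
  \<open>\<Omega>\<close>. Indeed, extending \<open>\<phi>|\<Omega>\<close> by zero gives again an eigenfunction (\<open>eigenfunction_cutoff\<close>):
  the operator only sees neighbours, and two layers of zeros inside \<open>\<Omega>\<close> hide the cut. By
  \<open>\<lambda>\<close>-uniqueness the extension is zero.

  The rank estimate is made without operators (\<open>local_trace_le_card\<close>): Gram-Schmidt applied to
  the kernels at the points of \<open>\<partial>\<^sub>2\<Omega>\<close> gives at most \<open>|\<partial>\<^sub>2\<Omega>|\<close> orthonormal eigenfunctions \<open>u\<close> such that
  \<open>k\<^sub>x(x) = \<Sum>\<^sub>u |u(x)|\<^sup>2 m(x)\<close> for all \<open>x\<close> in \<open>\<Omega>\<close>, and each \<open>u\<close> contributes at most its squared norm.
  The existence of \<open>P\<close> comes from the completeness of the weighted sequence space and the closedness of \<open>S\<close>.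
\<close>

section \<open>Orthogonal projection in a weighted sequence space\<close>

locale weighted_l2 =
  fixes V :: "'v set" and m :: "'v \<Rightarrow> real"
  assumes m_pos: "x \<in> V \<Longrightarrow> 0 < m x"
begin

abbreviation ip :: "('v \<Rightarrow> complex) \<Rightarrow> ('v \<Rightarrow> complex) \<Rightarrow> complex" where
  "ip \<equiv> l2_inner V m"

definition normsq :: "('v \<Rightarrow> complex) \<Rightarrow> real" where
  "normsq f = (\<Sum>\<^sub>\<infinity>x\<in>V. (cmod (f x))\<^sup>2 * m x)"

lemma l2_off: "f \<in> l2 V m \<Longrightarrow> x \<notin> V \<Longrightarrow> f x = 0"
  by (simp add: l2_def)

lemma l2_summable: "f \<in> l2 V m \<Longrightarrow> (\<lambda>x. (cmod (f x))\<^sup>2 * m x) summable_on V"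
  by (simp add: l2_def)

lemma l2_bounded_by:
  assumes "f \<in> l2 V m" "g \<in> l2 V m" "\<And>x. x \<notin> V \<Longrightarrow> h x = 0"
    and "\<And>x. x \<in> V \<Longrightarrow> (cmod (h x))\<^sup>2 \<le> a * (cmod (f x))\<^sup>2 + b * (cmod (g x))\<^sup>2"
  shows "h \<in> l2 V m"
proof -
  have "(\<lambda>x. a * ((cmod (f x))\<^sup>2 * m x) + b * ((cmod (g x))\<^sup>2 * m x)) summable_on V"
    by (intro summable_on_add summable_on_cmult_right l2_summable assms)
  then have "(\<lambda>x. (cmod (h x))\<^sup>2 * m x) summable_on V"
  proof (rule summable_on_comparison_test)
    fix x assume x: "x \<in> V"
    have "(cmod (h x))\<^sup>2 * m x \<le> (a * (cmod (f x))\<^sup>2 + b * (cmod (g x))\<^sup>2) * m x"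
      using assms(4)[OF x] m_pos[OF x] by (intro mult_right_mono) auto
    then show "(cmod (h x))\<^sup>2 * m x \<le> a * ((cmod (f x))\<^sup>2 * m x) + b * ((cmod (g x))\<^sup>2 * m x)"
      by (simp add: algebra_simps)
    show "0 \<le> (cmod (h x))\<^sup>2 * m x" using m_pos[OF x] by auto
  qed
  then show ?thesis using assms(3) by (simp add: l2_def)
qed

lemma l2_lincomb:
  assumes "f \<in> l2 V m" "g \<in> l2 V m"
  shows "(\<lambda>x. a * f x + b * g x) \<in> l2 V m"
proof (rule l2_bounded_by[OF assms])
  fix x
  have "(cmod (a * f x + b * g x))\<^sup>2 \<le> (cmod (a * f x) + cmod (b * g x))\<^sup>2"
    by (intro power_mono norm_triangle_ineq) auto
  also have "\<dots> \<le> 2 * (cmod (a * f x))\<^sup>2 + 2 * (cmod (b * g x))\<^sup>2"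
    using sum_squares_bound[of "cmod (a * f x)" "cmod (b * g x)"]
    by (simp add: power2_sum)
  finally show "(cmod (a * f x + b * g x))\<^sup>2
      \<le> (2 * (cmod a)\<^sup>2) * (cmod (f x))\<^sup>2 + (2 * (cmod b)\<^sup>2) * (cmod (g x))\<^sup>2"
    by (simp add: norm_mult power_mult_distrib)
qed (use assms in \<open>simp add: l2_off\<close>)

lemma l2_diff: "f \<in> l2 V m \<Longrightarrow> g \<in> l2 V m \<Longrightarrow> (\<lambda>x. f x - g x) \<in> l2 V m"
  using l2_lincomb[of f g 1 "-1"] by simp

lemma l2_finite_support:
  assumes "finite A" "\<And>x. x \<notin> A \<Longrightarrow> f x = 0" "\<And>x. x \<notin> V \<Longrightarrow> f x = 0"
  shows "f \<in> l2 V m"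
proof -
  have "(\<lambda>x. (cmod (f x))\<^sup>2 * m x) summable_on V \<longleftrightarrow>
        (\<lambda>x. (cmod (f x))\<^sup>2 * m x) summable_on (V \<inter> A)"
    using assms(2) by (intro summable_on_cong_neutral) auto
  then show ?thesis using assms by (simp add: l2_def)
qed

lemma indicator_l2: "x \<in> V \<Longrightarrow> (indicator {x} :: 'v \<Rightarrow> complex) \<in> l2 V m"
  by (rule l2_finite_support[of "{x}"]) (auto simp: indicator_def)

lemma ip_summable:
  assumes "f \<in> l2 V m" "g \<in> l2 V m"
  shows "(\<lambda>x. f x * cnj (g x) * of_real (m x)) summable_on V"
proof (rule abs_summable_summable, rule abs_summable_on_comparison_test')
  show "(\<lambda>x. (cmod (f x))\<^sup>2 * m x + (cmod (g x))\<^sup>2 * m x) summable_on V"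
    by (intro summable_on_add l2_summable assms)
  fix x assume x: "x \<in> V"
  have "cmod (f x) * cmod (g x) \<le> (cmod (f x))\<^sup>2 + (cmod (g x))\<^sup>2"
    using sum_squares_bound[of "cmod (f x)" "cmod (g x)"]
      mult_nonneg_nonneg[OF norm_ge_zero norm_ge_zero, of "f x" "g x"] by linarith
  then have "cmod (f x) * cmod (g x) * m x \<le> ((cmod (f x))\<^sup>2 + (cmod (g x))\<^sup>2) * m x"
    using m_pos[OF x] by (intro mult_right_mono) auto
  then show "cmod (f x * cnj (g x) * complex_of_real (m x))
      \<le> (cmod (f x))\<^sup>2 * m x + (cmod (g x))\<^sup>2 * m x"
    using m_pos[OF x] by (simp add: norm_mult algebra_simps)
qed

lemma ip_lincomb_left:
  assumes "f \<in> l2 V m" "g \<in> l2 V m" "h \<in> l2 V m"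
  shows "ip (\<lambda>x. a * f x + b * g x) h = a * ip f h + b * ip g h"
proof -
  have "ip (\<lambda>x. a * f x + b * g x) h = (\<Sum>\<^sub>\<infinity>x\<in>V. a * (f x * cnj (h x) * of_real (m x))
      + b * (g x * cnj (h x) * of_real (m x)))"
    unfolding l2_inner_def by (intro infsum_cong) (simp add: algebra_simps)
  also have "\<dots> = (\<Sum>\<^sub>\<infinity>x\<in>V. a * (f x * cnj (h x) * of_real (m x)))
      + (\<Sum>\<^sub>\<infinity>x\<in>V. b * (g x * cnj (h x) * of_real (m x)))"
    by (rule infsum_add; rule summable_on_cmult_right; rule ip_summable; rule assms)
  also have "\<dots> = a * ip f h + b * ip g h"
    unfolding l2_inner_def by (simp only: infsum_cmult_right')
  finally show ?thesis .
qed

lemma ip_cnj: "cnj (ip f g) = ip g f"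
  unfolding l2_inner_def infsum_cnj[symmetric]
  by (intro infsum_cong) (simp add: mult.commute)

lemma ip_lincomb_right:
  assumes "f \<in> l2 V m" "g \<in> l2 V m" "h \<in> l2 V m"
  shows "ip h (\<lambda>x. a * f x + b * g x) = cnj a * ip h f + cnj b * ip h g"
proof -
  have "ip h (\<lambda>x. a * f x + b * g x) = cnj (a * ip f h + b * ip g h)"
    by (simp only: ip_lincomb_left[OF assms, symmetric] ip_cnj)
  then show ?thesis by (simp add: ip_cnj)
qed

lemma ip_diff_left:
  assumes "f \<in> l2 V m" "g \<in> l2 V m" "h \<in> l2 V m"
  shows "ip (\<lambda>x. f x - g x) h = ip f h - ip g h"
  using ip_lincomb_left[OF assms, of 1 "-1"] by simp

lemma ip_sum_left:
  assumes "finite A" "\<And>u. u \<in> A \<Longrightarrow> F u \<in> l2 V m" "h \<in> l2 V m"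
  shows "(\<lambda>x. \<Sum>u\<in>A. c u * F u x) \<in> l2 V m \<and>
    ip (\<lambda>x. \<Sum>u\<in>A. c u * F u x) h = (\<Sum>u\<in>A. c u * ip (F u) h)"
  using assms
proof (induction A rule: finite_induct)
  case empty
  show ?case by (simp add: l2_def l2_inner_def)
next
  case (insert u A)
  then have "(\<lambda>x. \<Sum>u\<in>A. c u * F u x) \<in> l2 V m" "F u \<in> l2 V m" by auto
  with insert show ?case
    using l2_lincomb[of "F u" "\<lambda>x. \<Sum>u\<in>A. c u * F u x" "c u" 1]
      ip_lincomb_left[of "F u" "\<lambda>x. \<Sum>u\<in>A. c u * F u x" h "c u" 1] by simp
qed

lemma ip_indicator: "x \<in> V \<Longrightarrow> ip f (indicator {x}) = f x * of_real (m x)"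
proof -
  assume "x \<in> V"
  then have "ip f (indicator {x}) = (\<Sum>\<^sub>\<infinity>y\<in>{x}. f y * of_real (m y))"
    unfolding l2_inner_def by (intro infsum_cong_neutral) (auto simp: indicator_def)
  then show ?thesis by simp
qed

lemma ip_self:
  assumes "f \<in> l2 V m"
  shows "ip f f = of_real (normsq f)"
proof -
  have "ip f f = (\<Sum>\<^sub>\<infinity>x\<in>V. of_real ((cmod (f x))\<^sup>2 * m x))"
    unfolding l2_inner_def
    by (intro infsum_cong) (simp add: complex_norm_square[symmetric])
  also have "\<dots> = of_real (normsq f)"
    unfolding normsq_def by (intro infsumI has_sum_of_real has_sum_infsum l2_summable assms)
  finally show ?thesis .
qed

lemma normsq_nonneg: "0 \<le> normsq f"
  unfolding normsq_def by (intro infsum_nonneg) (use m_pos in \<open>auto simp: less_imp_le\<close>)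

lemma finite_sum_le_normsq:
  assumes "f \<in> l2 V m" "finite A" "A \<subseteq> V"
  shows "(\<Sum>x\<in>A. (cmod (f x))\<^sup>2 * m x) \<le> normsq f"
  unfolding normsq_def
  by (intro finite_sum_le_infsum l2_summable assms) (use m_pos in \<open>auto simp: less_imp_le\<close>)

lemma point_le_normsq: "f \<in> l2 V m \<Longrightarrow> x \<in> V \<Longrightarrow> (cmod (f x))\<^sup>2 * m x \<le> normsq f"
  using finite_sum_le_normsq[of f "{x}"] by simp

lemma normsq_eq_0:
  assumes "f \<in> l2 V m" "normsq f = 0"
  shows "f x = 0"
proof (cases "x \<in> V")
  case True
  then show ?thesis
    using point_le_normsq[OF assms(1) True] m_pos[OF True] assms(2)
    by (simp add: mult_le_0_iff)
qed (use assms l2_off in auto)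

lemma normsq_add_scaled:
  assumes "f \<in> l2 V m" "g \<in> l2 V m"
  shows "normsq (\<lambda>x. f x + c * g x) = normsq f + 2 * Re (cnj c * ip f g) + (cmod c)\<^sup>2 * normsq g"
proof -
  let ?h = "\<lambda>x. f x + c * g x"
  have h: "?h \<in> l2 V m" using l2_lincomb[OF assms, of 1 c] by simp
  have cc: "c * cnj c = (complex_of_real (cmod c))\<^sup>2"
    by (simp only: complex_norm_square[symmetric] of_real_power)
  have "ip ?h ?h = ip f ?h + c * ip g ?h"
    using ip_lincomb_left[OF assms h, of 1 c] by simp
  also have "\<dots> = ip f f + cnj c * ip f g + c * (ip g f + cnj c * ip g g)"
    using ip_lincomb_right[OF assms assms(1), of 1 c] ip_lincomb_right[OF assms assms(2), of 1 c]
    by simp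
  also have "\<dots> = of_real (normsq f) + (cnj c * ip f g + cnj (cnj c * ip f g))
      + of_real ((cmod c)\<^sup>2 * normsq g)"
    by (simp add: ip_self assms ip_cnj algebra_simps cc)
  also have "cnj c * ip f g + cnj (cnj c * ip f g) = of_real (2 * Re (cnj c * ip f g))"
    by (simp only: complex_add_cnj)
  finally have "complex_of_real (normsq ?h) = of_real (normsq f + 2 * Re (cnj c * ip f g)
      + (cmod c)\<^sup>2 * normsq g)"
    by (simp only: ip_self[OF h] of_real_add)
  then show ?thesis by (simp only: of_real_eq_iff)
qed

text \<open>
  The squared norm is a supremum of finite sums, each of which is continuous under pointwise
  convergence. This form of Fatou's lemma gives both completeness of the space and the
  optimality of a limit of a minimizing sequence.
\<close>

lemma l2_pointwise_limit:
  assumes "\<And>n. F n \<in> l2 V m" "\<And>x. (\<lambda>n. F n x) \<longlonglongrightarrow> f x"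
    and "\<And>n. normsq (F n) \<le> C n" "C \<longlonglongrightarrow> c"
  shows "f \<in> l2 V m" "normsq f \<le> c"
proof -
  have part: "(\<Sum>x\<in>A. (cmod (f x))\<^sup>2 * m x) \<le> c" if A: "finite A" "A \<subseteq> V" for A
  proof (rule LIMSEQ_le)
    show "(\<lambda>n. \<Sum>x\<in>A. (cmod (F n x))\<^sup>2 * m x) \<longlonglongrightarrow> (\<Sum>x\<in>A. (cmod (f x))\<^sup>2 * m x)"
      by (intro tendsto_intros assms(2))
    show "\<exists>N. \<forall>n\<ge>N. (\<Sum>x\<in>A. (cmod (F n x))\<^sup>2 * m x) \<le> C n"
      using finite_sum_le_normsq[OF assms(1) A] assms(3) order_trans by blast
  qed (rule assms(4))
  have "(\<lambda>x. (cmod (f x))\<^sup>2 * m x) summable_on V"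
  proof (rule nonneg_bdd_above_summable_on)
    show "bdd_above (sum (\<lambda>x. (cmod (f x))\<^sup>2 * m x) ` {A. A \<subseteq> V \<and> finite A})"
      by (rule bdd_aboveI2[where M = c]) (use part in auto)
  qed (use m_pos in \<open>auto simp: less_imp_le\<close>)
  moreover have "f x = 0" if "x \<notin> V" for x
    using assms(2)[of x] by (simp add: l2_off[OF assms(1) that] LIMSEQ_const_iff)
  ultimately show "f \<in> l2 V m" by (simp add: l2_def)
  then show "normsq f \<le> c"
    unfolding normsq_def by (intro infsum_le_finite_sums l2_summable part)
qed

text \<open>
  A Cauchy sequence converges pointwise, because the weight of a point is positive; letting \<open>k\<close>
  tend to infinity in the bound for \<open>F n - F k\<close> turns this into convergence in norm.
\<close>

lemma l2_complete:
  assumes F: "\<And>n. F n \<in> l2 V m"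
    and C: "\<And>n k. normsq (\<lambda>x. F n x - F k x) \<le> \<epsilon> n + \<epsilon> k" and \<epsilon>: "\<epsilon> \<longlonglongrightarrow> 0"
  obtains f where "f \<in> l2 V m" "\<And>x. (\<lambda>n. F n x) \<longlonglongrightarrow> f x"
    "(\<lambda>n. normsq (\<lambda>x. F n x - f x)) \<longlonglongrightarrow> 0"
proof -
  have "convergent (\<lambda>n. F n x)" for x
  proof (cases "x \<in> V")
    case x: True
    show ?thesis
    proof (rule Cauchy_convergent, rule CauchyI)
      fix e :: real assume e: "0 < e"
      then have "0 < e\<^sup>2 * m x / 2" using m_pos[OF x] by simp
      with \<epsilon> obtain M where M: "\<And>n. n \<ge> M \<Longrightarrow> norm (\<epsilon> n - 0) < e\<^sup>2 * m x / 2"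
        by (meson LIMSEQ_D)
      have "cmod (F n x - F k x) < e" if "n \<ge> M" "k \<ge> M" for n k
      proof -
        have "(cmod (F n x - F k x))\<^sup>2 * m x \<le> \<epsilon> n + \<epsilon> k"
          using point_le_normsq[OF l2_diff[OF F F] x, of n k] C[of n k] by simp
        also have "\<dots> < e\<^sup>2 * m x" using M[OF that(1)] M[OF that(2)] by simp
        finally have "(cmod (F n x - F k x))\<^sup>2 < e\<^sup>2" using m_pos[OF x] by simp
        then show ?thesis using e by (simp add: power_less_imp_less_base)
      qed
      then show "\<exists>M. \<forall>n\<ge>M. \<forall>k\<ge>M. norm (F n x - F k x) < e" by blast
    qed
  next
    case False
    then have "(\<lambda>n. F n x) = (\<lambda>n. 0)" using l2_off[OF F] by auto
    then show ?thesis by (simp add: convergent_const)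
  qed
  then obtain f where f: "\<And>x. (\<lambda>n. F n x) \<longlonglongrightarrow> f x"
    unfolding convergent_def by metis
  have lim: "(\<lambda>x. F n x - f x) \<in> l2 V m \<and> normsq (\<lambda>x. F n x - f x) \<le> \<epsilon> n" for n
  proof -
    have "(\<lambda>k. \<epsilon> n + \<epsilon> k) \<longlonglongrightarrow> \<epsilon> n + 0" by (intro tendsto_intros \<epsilon>)
    moreover have "(\<lambda>k. F n x - F k x) \<longlonglongrightarrow> F n x - f x" for x
      by (intro tendsto_intros f)
    ultimately show ?thesis
      using l2_pointwise_limit[of "\<lambda>k x. F n x - F k x" "\<lambda>x. F n x - f x" "\<lambda>k. \<epsilon> n + \<epsilon> k" "\<epsilon> n + 0"]
        C l2_diff[OF F F] by auto
  qed
  have "f \<in> l2 V m" using l2_diff[OF F[of 0] conjunct1[OF lim[of 0]]] by simp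
  moreover have "(\<lambda>n. normsq (\<lambda>x. F n x - f x)) \<longlonglongrightarrow> 0"
    by (rule tendsto_sandwich[OF _ _ tendsto_const \<epsilon>]) (use lim normsq_nonneg in auto)
  ultimately show ?thesis using that f by blast
qed

end

text \<open>
  Closedness is stated for a limit already known to lie in the space, which is what completeness
  supplies.
\<close>

locale closed_l2_subspace = weighted_l2 +
  fixes S :: "('a \<Rightarrow> complex) set"
  assumes S_l2: "f \<in> S \<Longrightarrow> f \<in> l2 V m"
    and S_zero: "(\<lambda>x. 0) \<in> S"
    and S_lincomb: "\<lbrakk>f \<in> S; g \<in> S\<rbrakk> \<Longrightarrow> (\<lambda>x. a * f x + b * g x) \<in> S"
    and S_closed: "\<lbrakk>\<And>n. F n \<in> S; f \<in> l2 V m; (\<lambda>n. normsq (\<lambda>x. F n x - f x)) \<longlonglongrightarrow> 0\<rbrakk>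
      \<Longrightarrow> f \<in> S"
begin

text \<open>
  By the parallelogram law, a minimizing sequence for the distance is Cauchy: the midpoint of two
  nearly optimal points lies in the subspace, so it cannot be much closer to \<open>f\<close> than they are.
\<close>

lemma nearest_point_exists:
  assumes f: "f \<in> l2 V m"
  obtains g where "g \<in> S" "\<And>h. h \<in> S \<Longrightarrow> normsq (\<lambda>x. f x - g x) \<le> normsq (\<lambda>x. f x - h x)"
proof -
  let ?N = "\<lambda>g. normsq (\<lambda>x. f x - g x)"
  define d where "d = Inf (?N ` S)"
  have bdd: "bdd_below (?N ` S)" by (rule bdd_belowI2[where m = 0]) (rule normsq_nonneg)
  have d_le: "d \<le> ?N g" if "g \<in> S" for g
    unfolding d_def by (intro cInf_lower bdd) (use that in auto)
  have "\<exists>g\<in>S. ?N g < d + 1 / Suc n" for n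
  proof -
    have "Inf (?N ` S) < d + 1 / Suc n" by (simp add: d_def)
    then show ?thesis using cInf_lessD[of "?N ` S"] S_zero by blast
  qed
  then obtain G where G: "\<And>n. G n \<in> S" "\<And>n. ?N (G n) < d + 1 / Suc n" by metis
  have cauchy: "normsq (\<lambda>x. G n x - G k x) \<le> 2 / Suc n + 2 / Suc k" for n k
  proof -
    let ?a = "\<lambda>x. f x - G n x" and ?b = "\<lambda>x. f x - G k x"
    have ab: "?a \<in> l2 V m" "?b \<in> l2 V m" using f G S_l2 l2_diff by auto
    have mid: "(\<lambda>x. 1/2 * G n x + 1/2 * G k x) \<in> S" by (intro S_lincomb G)
    have abz: "(\<lambda>x. ?a x + 1 * ?b x) \<in> l2 V m"
      using l2_lincomb[OF ab, of 1 1] by simp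
    \<comment> \<open>The summand \<open>0\<close> brings the scaled function into the shape of the expansion of a squared norm.\<close>
    have "normsq (\<lambda>x. 0 + (1/2) * (?a x + 1 * ?b x)) = 1/4 * normsq (\<lambda>x. ?a x + 1 * ?b x)"
      using normsq_add_scaled[OF S_l2[OF S_zero] abz, of "1/2"]
      by (simp add: normsq_def l2_inner_def power2_eq_square)
    moreover have "(\<lambda>x. 0 + (1/2) * (?a x + 1 * ?b x)) = (\<lambda>x. f x - (1/2 * G n x + 1/2 * G k x))"
      by (simp add: fun_eq_iff field_simps)
    ultimately have "4 * d \<le> normsq (\<lambda>x. ?a x + 1 * ?b x)"
      using d_le[OF mid] by simp
    moreover have "(\<lambda>x. ?a x + (-1) * ?b x) = (\<lambda>x. - 1 * (G n x - G k x))" by auto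
    moreover have "normsq (\<lambda>x. - 1 * (G n x - G k x)) = normsq (\<lambda>x. G n x - G k x)"
      by (simp add: normsq_def norm_minus_commute)
    ultimately show ?thesis
      using normsq_add_scaled[OF ab, of 1] normsq_add_scaled[OF ab, of "-1"] G(2)[of n] G(2)[of k]
      by simp
  qed
  have lim0: "(\<lambda>n. c / real (Suc n)) \<longlonglongrightarrow> 0" for c
    using tendsto_mult[OF tendsto_const[of c] LIMSEQ_inverse_real_of_nat] by (simp add: divide_inverse)
  obtain g where g: "g \<in> l2 V m" "\<And>x. (\<lambda>n. G n x) \<longlonglongrightarrow> g x"
    "(\<lambda>n. normsq (\<lambda>x. G n x - g x)) \<longlonglongrightarrow> 0"
    using l2_complete[OF S_l2[OF G(1)] cauchy lim0] by blast
  have "g \<in> S" using S_closed G(1) g by blast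
  have "?N g \<le> d"
  proof (rule l2_pointwise_limit(2)[of "\<lambda>n x. f x - G n x"])
    show "(\<lambda>n. f x - G n x) \<longlonglongrightarrow> f x - g x" for x by (intro tendsto_intros g)
    show "normsq (\<lambda>x. f x - G n x) \<le> d + 1 / real (Suc n)" for n using G(2)[of n] by simp
    show "(\<lambda>n. d + 1 / real (Suc n)) \<longlonglongrightarrow> d" using tendsto_add[OF tendsto_const[of d] lim0[of 1]] by simp
  qed (use f G S_l2 l2_diff in auto)
  then have "?N g \<le> ?N h" if "h \<in> S" for h using d_le[OF that] by simp
  with \<open>g \<in> S\<close> show ?thesis using that by blast
qed

text \<open>
  Moving from the nearest point \<open>g\<close> by a small multiple of \<open>a h\<close>, where \<open>a\<close> is the inner product
  of \<open>f - g\<close> with \<open>h\<close>, would decrease the distance to first order unless \<open>a = 0\<close>.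
\<close>

lemma nearest_point_orthogonal:
  assumes f: "f \<in> l2 V m" and g: "g \<in> S"
    and near: "\<And>h. h \<in> S \<Longrightarrow> normsq (\<lambda>x. f x - g x) \<le> normsq (\<lambda>x. f x - h x)" and h: "h \<in> S"
  shows "ip (\<lambda>x. f x - g x) h = 0"
proof -
  let ?r = "\<lambda>x. f x - g x"
  define a where "a = ip ?r h"
  \<comment> \<open>With this step size the second-order term is at most half of the first-order gain.\<close>
  define t where "t = 1 / (normsq h + 1)"
  have t: "0 < t" "t * normsq h \<le> 1"
    using normsq_nonneg[of h] by (auto simp: t_def field_simps)
  have r: "?r \<in> l2 V m" using f g S_l2 l2_diff by auto
  have "(\<lambda>x. 1 * g x + (of_real t * a) * h x) \<in> S" by (intro S_lincomb g h)
  moreover have "(\<lambda>x. ?r x + (- (of_real t * a)) * h x) = (\<lambda>x. f x - (1 * g x + (of_real t * a) * h x))"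
    by (simp add: fun_eq_iff algebra_simps)
  ultimately have "normsq ?r \<le> normsq (\<lambda>x. ?r x + (- (of_real t * a)) * h x)"
    using near by simp
  also have "\<dots> = normsq ?r + 2 * Re (cnj (- (of_real t * a)) * ip ?r h)
      + (cmod (- (of_real t * a)))\<^sup>2 * normsq h"
    by (rule normsq_add_scaled[OF r S_l2[OF h]])
  also have "Re (cnj (- (of_real t * a)) * ip ?r h) = - t * (cmod a)\<^sup>2"
    unfolding a_def[symmetric] by (simp add: cmod_def power2_eq_square algebra_simps)
  also have "(cmod (- (of_real t * a)))\<^sup>2 = t\<^sup>2 * (cmod a)\<^sup>2"
    by (simp add: norm_mult power_mult_distrib)
  finally have "2 * t * (cmod a)\<^sup>2 \<le> t * (cmod a)\<^sup>2 * (t * normsq h)"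
    by (simp add: power2_eq_square algebra_simps)
  also have "\<dots> \<le> t * (cmod a)\<^sup>2 * 1" using t by (intro mult_left_mono) auto
  finally have "t * (cmod a)\<^sup>2 \<le> 0" by simp
  then have "a = 0" using t(1) by (simp add: mult_le_0_iff)
  then show ?thesis by (simp add: a_def)
qed

lemma orth_proj_unique:
  assumes f: "f \<in> l2 V m"
    and g: "g \<in> S" "\<And>h. h \<in> S \<Longrightarrow> ip (\<lambda>x. f x - g x) h = 0"
    and k: "k \<in> S" "\<And>h. h \<in> S \<Longrightarrow> ip (\<lambda>x. f x - k x) h = 0"
  shows "g = k"
proof -
  let ?d = "\<lambda>x. 1 * g x + (-1) * k x"
  have d: "?d \<in> S" by (intro S_lincomb g k)
  have "ip (\<lambda>x. (f x - k x) - (f x - g x)) ?d = 0"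
    by (subst ip_diff_left) (use f g k d S_l2 l2_diff in auto)
  moreover have "(\<lambda>x. (f x - k x) - (f x - g x)) = ?d" by auto
  ultimately have "normsq ?d = 0" using ip_self[OF S_l2[OF d]] by simp
  then show ?thesis using normsq_eq_0[OF S_l2[OF d]] by (simp add: fun_eq_iff)
qed

text \<open>
  The operator is defined by a definite description, so the way to compute a projection is to
  exhibit a point of the subspace with orthogonal residual.
\<close>

lemma orth_proj_eqI:
  assumes f: "f \<in> l2 V m" and g: "g \<in> S" "\<And>h. h \<in> S \<Longrightarrow> ip (\<lambda>x. f x - g x) h = 0"
  shows "orth_proj V m S f = g"
  unfolding orth_proj_def using g orth_proj_unique[OF f] by (intro the_equality) auto

lemma orth_proj:
  assumes f: "f \<in> l2 V m"
  shows "orth_proj V m S f \<in> S" "h \<in> S \<Longrightarrow> ip (\<lambda>x. f x - orth_proj V m S f x) h = 0"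
proof -
  obtain g where g: "g \<in> S" "\<And>h. h \<in> S \<Longrightarrow> normsq (\<lambda>x. f x - g x) \<le> normsq (\<lambda>x. f x - h x)"
    using nearest_point_exists[OF f] by blast
  have orth: "ip (\<lambda>x. f x - g x) h = 0" if "h \<in> S" for h
    by (rule nearest_point_orthogonal[OF f g that])
  have "orth_proj V m S f = g" using g(1) orth by (rule orth_proj_eqI[OF f])
  with g orth show "orth_proj V m S f \<in> S"
    "h \<in> S \<Longrightarrow> ip (\<lambda>x. f x - orth_proj V m S f x) h = 0" by auto
qed

end

section \<open>Reproducing kernels and local traces\<close>

context closed_l2_subspace
begin

text \<open>
  This is \<open>m x\<close> times the reproducing kernel of \<open>S\<close> at \<open>x\<close>, for the inner product weighted by \<open>m\<close>.
\<close>

abbreviation kernel :: "'a \<Rightarrow> 'a \<Rightarrow> complex" where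
  "kernel x \<equiv> orth_proj V m S (indicator {x})"

lemma kernel_in: "x \<in> V \<Longrightarrow> kernel x \<in> S"
  by (rule orth_proj(1)[OF indicator_l2])

lemma ip_indicator_left: "x \<in> V \<Longrightarrow> ip (indicator {x}) h = cnj (h x) * of_real (m x)"
  using arg_cong[OF ip_indicator[of x h], of cnj] by (simp add: ip_cnj)

lemma kernel_reproducing:
  assumes "x \<in> V" "h \<in> S"
  shows "ip (kernel x) h = cnj (h x) * of_real (m x)"
proof -
  have "ip (\<lambda>y. indicator {x} y - kernel x y) h = 0"
    by (rule orth_proj(2)[OF indicator_l2]) (use assms in auto)
  then have "ip (kernel x) h = ip (indicator {x}) h"
    using ip_diff_left[OF indicator_l2 S_l2 S_l2, of x "kernel x" h] kernel_in assms by simp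
  then show ?thesis using ip_indicator_left assms by simp
qed

lemma kernel_eqI:
  assumes "x \<in> V" "k \<in> S" "\<And>h. h \<in> S \<Longrightarrow> ip k h = cnj (h x) * of_real (m x)"
  shows "kernel x = k"
proof (rule orth_proj_eqI[OF indicator_l2])
  show "ip (\<lambda>y. indicator {x} y - k y) h = 0" if "h \<in> S" for h
    using ip_diff_left[OF indicator_l2 S_l2 S_l2, of x k h] assms that ip_indicator_left by simp
qed (use assms in auto)

text \<open>
  The left-hand side is the term of \<open>x\<close> in the trace.
\<close>

lemma kernel_diagonal: "x \<in> V \<Longrightarrow> Re (ip (kernel x) (indicator {x})) / m x = Re (kernel x x)"
  using m_pos[of x] by (simp add: ip_indicator)

lemma kernel_diagonal_nonneg:
  assumes "x \<in> V"
  shows "0 \<le> Re (kernel x x)"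
proof -
  have "complex_of_real (normsq (kernel x)) = cnj (kernel x x) * of_real (m x)"
    using kernel_reproducing[OF assms kernel_in[OF assms]] ip_self[OF S_l2[OF kernel_in[OF assms]]]
    by simp
  from arg_cong[OF this, of Re] have "normsq (kernel x) = Re (kernel x x) * m x" by simp
  then show ?thesis
    using normsq_nonneg[of "kernel x"] m_pos[OF assms] by (simp add: zero_le_mult_iff)
qed

definition orthonormal :: "('a \<Rightarrow> complex) set \<Rightarrow> bool" where
  "orthonormal U \<longleftrightarrow> finite U \<and> U \<subseteq> S \<and> (\<forall>u\<in>U. \<forall>v\<in>U. ip u v = (if u = v then 1 else 0))"

lemma S_sum:
  assumes "finite U" "U \<subseteq> S"
  shows "(\<lambda>x. \<Sum>u\<in>U. c u * u x) \<in> S"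
  using assms
proof (induction U rule: finite_induct)
  case (insert u U)
  then show ?case using S_lincomb[of u "\<lambda>x. \<Sum>u\<in>U. c u * u x" "c u" 1] by simp
qed (simp add: S_zero)

lemma orthonormal_residual:
  assumes U: "orthonormal U" and f: "f \<in> S"
  defines "r \<equiv> \<lambda>x. f x - (\<Sum>u\<in>U. ip f u * u x)"
  shows "r \<in> S" "v \<in> U \<Longrightarrow> ip r v = 0"
proof -
  let ?s = "\<lambda>x. \<Sum>u\<in>U. ip f u * u x"
  have s: "?s \<in> S" using U by (intro S_sum) (auto simp: orthonormal_def)
  show "r \<in> S" using S_lincomb[OF f s, of 1 "-1"] by (simp add: r_def)
  assume v: "v \<in> U"
  have US: "u \<in> l2 V m" if "u \<in> U" for u using U that S_l2 by (auto simp: orthonormal_def)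
  have "ip ?s v = (\<Sum>u\<in>U. ip f u * ip u v)"
    using ip_sum_left[of U "\<lambda>u. u" v "\<lambda>u. ip f u"] U US v by (auto simp: orthonormal_def)
  also have "\<dots> = (\<Sum>u\<in>U. if u = v then ip f u else 0)"
    using U v by (intro sum.cong) (auto simp: orthonormal_def)
  also have "\<dots> = ip f v" using U v by (simp add: orthonormal_def)
  finally show "ip r v = 0"
    unfolding r_def using ip_diff_left[OF S_l2[OF f] S_l2[OF s] US[OF v]] by simp
qed

text \<open>
  The span of the family contains the kernels at the points of \<open>B\<close>; vanishing on \<open>B\<close> is orthogonality to these
  kernels. It is built by Gram-Schmidt, adding at each point \<open>b\<close> the normalized residual of the
  kernel at \<open>b\<close>, or nothing if this residual is zero, which means that the
  functions orthogonal to the family so far vanish at \<open>b\<close> anyway.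
\<close>

lemma orthonormal_detecting:
  assumes "finite B" "B \<subseteq> V"
  obtains U where "orthonormal U" "card U \<le> card B"
    "\<And>f b. \<lbrakk>f \<in> S; \<And>u. u \<in> U \<Longrightarrow> ip f u = 0; b \<in> B\<rbrakk> \<Longrightarrow> f b = 0"
proof -
  have "\<exists>U. orthonormal U \<and> card U \<le> card B \<and>
      (\<forall>f\<in>S. (\<forall>u\<in>U. ip f u = 0) \<longrightarrow> (\<forall>b\<in>B. f b = 0))"
    using assms
  proof (induction B rule: finite_induct)
    case empty
    show ?case by (rule exI[of _ "{}"]) (simp add: orthonormal_def)
  next
    case (insert b B)
    then obtain U where U: "orthonormal U" "card U \<le> card B"
      and det: "\<forall>f\<in>S. (\<forall>u\<in>U. ip f u = 0) \<longrightarrow> (\<forall>b\<in>B. f b = 0)"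
      by auto
    have finU: "finite U" using U by (simp add: orthonormal_def)
    have b: "b \<in> V" using insert by simp
    define r where "r = (\<lambda>x. kernel b x - (\<Sum>u\<in>U. ip (kernel b) u * u x))"
    have rS: "r \<in> S" and r0: "\<And>v. v \<in> U \<Longrightarrow> ip r v = 0"
      using orthonormal_residual[OF U(1) kernel_in[OF b]] unfolding r_def by auto
    have US: "u \<in> l2 V m" if "u \<in> U" for u using U that S_l2 by (auto simp: orthonormal_def)
    \<comment> \<open>On the orthogonal complement of \<open>U\<close> the residual still reproduces the value at \<open>b\<close>.\<close>
    have ip_r: "ip r f = cnj (f b) * of_real (m b)" if f: "f \<in> S" "\<And>u. u \<in> U \<Longrightarrow> ip f u = 0" for f
    proof -
      have uf: "ip u f = 0" if "u \<in> U" for u using f(2)[OF that] ip_cnj[of f u] by simp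
      have "(\<lambda>x. \<Sum>u\<in>U. ip (kernel b) u * u x) \<in> l2 V m"
        "ip (\<lambda>x. \<Sum>u\<in>U. ip (kernel b) u * u x) f = 0"
        using ip_sum_left[of U "\<lambda>u. u" f "\<lambda>u. ip (kernel b) u"] finU US S_l2[OF f(1)] uf by auto
      then show ?thesis
        unfolding r_def using ip_diff_left[of "kernel b" _ f] S_l2 kernel_in[OF b] f(1)
          kernel_reproducing[OF b f(1)] by simp
    qed
    show ?case
    proof (cases "normsq r = 0")
      case True
      then have r_zero: "r = (\<lambda>x. 0)" using normsq_eq_0[OF S_l2[OF rS]] by auto
      have "f b = 0" if "f \<in> S" "\<And>u. u \<in> U \<Longrightarrow> ip f u = 0" for f
      proof -
        have "ip r f = 0" by (simp add: r_zero l2_inner_def)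
        then show ?thesis using ip_r[OF that] m_pos[OF b] by simp
      qed
      then show ?thesis using U det insert by (intro exI[of _ U]) auto
    next
      case False
      then have pos: "0 < normsq r" using normsq_nonneg[of r] by simp
      define c where "c = complex_of_real (1 / sqrt (normsq r))"
      define w where "w = (\<lambda>x. c * r x)"
      have c0: "c \<noteq> 0" using pos by (simp add: c_def)
      have wS: "w \<in> S" using S_lincomb[OF rS rS, of c 0] by (simp add: w_def)
      have w_left: "ip w h = c * ip r h" if "h \<in> l2 V m" for h
        using ip_lincomb_left[OF S_l2[OF rS] S_l2[OF rS] that, of c 0] by (simp add: w_def)
      have wu: "ip w u = 0" if "u \<in> U" for u using w_left[OF US[OF that]] r0[OF that] by simp
      then have uw: "ip u w = 0" if "u \<in> U" for u using that ip_cnj[of w u] by simp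
      have "ip r w = cnj (ip w r)" by (simp add: ip_cnj)
      then have "ip w w = c * cnj c * of_real (normsq r)"
        using w_left[OF S_l2[OF wS]] w_left[OF S_l2[OF rS]] ip_self[OF S_l2[OF rS]] by simp
      also have "\<dots> = of_real ((1 / sqrt (normsq r))\<^sup>2 * normsq r)"
        by (simp only: c_def power2_eq_square complex_cnj_complex_of_real of_real_mult)
      also have "\<dots> = 1" using pos by (simp add: power_divide)
      finally have ww: "ip w w = 1" .
      have "orthonormal (insert w U)"
        using U(1) wS ww wu uw by (auto simp: orthonormal_def)
      moreover have "card (insert w U) \<le> card (insert b B)"
        using U(2) insert finU by (simp add: card_insert_if)
      moreover have "\<forall>f\<in>S. (\<forall>u\<in>insert w U. ip f u = 0) \<longrightarrow> (\<forall>b\<in>insert b B. f b = 0)"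
      proof (intro ballI impI)
        fix f b' assume f: "f \<in> S" "\<forall>u\<in>insert w U. ip f u = 0" and b': "b' \<in> insert b B"
        have "ip w f = 0" using f(2) ip_cnj[of f w] by simp
        then have "ip r f = 0" using w_left[OF S_l2[OF f(1)]] c0 by simp
        then have "f b = 0" using ip_r[OF f(1)] f(2) m_pos[OF b] by simp
        moreover have "f y = 0" if "y \<in> B" for y using det f that by simp
        ultimately show "f b' = 0" using b' by auto
      qed
      ultimately show ?thesis by blast
    qed
  qed
  then show ?thesis using that by blast
qed

text \<open>
  Elements of \<open>S\<close> are determined on \<open>\<Omega>\<close> by their values on \<open>B\<close>. So the residual of the kernel at \<open>x\<close>
  in \<open>\<Omega>\<close>, after projection onto the span of an orthonormal family detecting \<open>B\<close>, vanishes at \<open>x\<close>.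
  This computes the diagonal value as a sum over the family, and the sum over \<open>\<Omega>\<close> of the
  contribution of one member is bounded by its squared norm \<open>1\<close>.
\<close>

lemma local_trace_le_card:
  assumes \<Omega>: "finite \<Omega>" "\<Omega> \<subseteq> V" and B: "B \<subseteq> \<Omega>"
    and unique: "\<And>f x. \<lbrakk>f \<in> S; \<And>b. b \<in> B \<Longrightarrow> f b = 0; x \<in> \<Omega>\<rbrakk> \<Longrightarrow> f x = 0"
  shows "(\<Sum>x\<in>\<Omega>. Re (kernel x x)) \<le> card B"
proof -
  have finB: "finite B" "B \<subseteq> V" using \<Omega> B finite_subset by auto
  obtain U where U: "orthonormal U" "card U \<le> card B"
    and det: "\<And>f b. \<lbrakk>f \<in> S; \<And>u. u \<in> U \<Longrightarrow> ip f u = 0; b \<in> B\<rbrakk> \<Longrightarrow> f b = 0"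
    using orthonormal_detecting[OF finB] by blast
  have US: "u \<in> S" if "u \<in> U" for u using U that by (auto simp: orthonormal_def)
  have diag: "Re (kernel x x) = (\<Sum>u\<in>U. (cmod (u x))\<^sup>2 * m x)" if x: "x \<in> \<Omega>" for x
  proof -
    have xV: "x \<in> V" using x \<Omega> by auto
    define r where "r = (\<lambda>y. kernel x y - (\<Sum>u\<in>U. ip (kernel x) u * u y))"
    have "r \<in> S" "\<And>v. v \<in> U \<Longrightarrow> ip r v = 0"
      using orthonormal_residual[OF U(1) kernel_in[OF xV]] unfolding r_def by auto
    then have "r x = 0" using unique det x by blast
    then have "kernel x x = (\<Sum>u\<in>U. ip (kernel x) u * u x)" by (simp add: r_def)
    also have "\<dots> = (\<Sum>u\<in>U. of_real ((cmod (u x))\<^sup>2 * m x))"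
    proof (rule sum.cong)
      fix u assume "u \<in> U"
      then have "ip (kernel x) u * u x = (u x * cnj (u x)) * of_real (m x)"
        using kernel_reproducing[OF xV US] by simp
      then show "ip (kernel x) u * u x = of_real ((cmod (u x))\<^sup>2 * m x)"
        by (simp only: complex_norm_square[symmetric] of_real_mult)
    qed simp
    finally show ?thesis by simp
  qed
  have "(\<Sum>x\<in>\<Omega>. Re (kernel x x)) = (\<Sum>u\<in>U. \<Sum>x\<in>\<Omega>. (cmod (u x))\<^sup>2 * m x)"
    using diag sum.swap by (simp cong: sum.cong)
  also have "\<dots> \<le> (\<Sum>u\<in>U. 1)"
  proof (rule sum_mono)
    fix u assume u: "u \<in> U"
    then have "of_real (normsq u) = (1 :: complex)"
      using ip_self[OF S_l2[OF US[OF u]]] U by (simp add: orthonormal_def)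
    then show "(\<Sum>x\<in>\<Omega>. (cmod (u x))\<^sup>2 * m x) \<le> 1"
      using finite_sum_le_normsq[OF S_l2[OF US[OF u]] \<Omega>] by simp
  qed
  also have "\<dots> \<le> card B" using U(2) by simp
  finally show ?thesis .
qed

end

section \<open>Sums over fundamental domains\<close>

context group_action
begin

lemma invariant_image_orbit:
  assumes inv: "\<And>g x. \<lbrakk>g \<in> carrier G; x \<in> E\<rbrakk> \<Longrightarrow> f (\<phi> g x) = f x" and x: "x \<in> E"
  shows "f ` orbit G \<phi> x = {f x}"
  using inv[OF _ x] orbit_refl[OF x] by (auto simp: orbit_def)

lemma invariant_finite_image:
  assumes inv: "\<And>g x. \<lbrakk>g \<in> carrier G; x \<in> E\<rbrakk> \<Longrightarrow> f (\<phi> g x) = f x"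
    and fin: "finite (orbits G E \<phi>)"
  shows "finite (f ` E)"
proof (rule finite_subset)
  have "f x \<in> (\<lambda>X. the_elem (f ` X)) ` orbits G E \<phi>" if "x \<in> E" for x
    using that invariant_image_orbit[of f, OF inv that]
    by (intro image_eqI[of _ _ "orbit G \<phi> x"]) (auto simp: orbits_def)
  then show "f ` E \<subseteq> (\<lambda>X. the_elem (f ` X)) ` orbits G E \<phi>" by blast
qed (use fin in simp)

lemma fundamental_domain_bij:
  assumes D: "fundamental_domain G E \<phi> D"
  shows "bij_betw (orbit G \<phi>) D (orbits G E \<phi>)"
proof -
  have DE: "D \<subseteq> E" and cover: "(\<Union>x\<in>D. orbit G \<phi> x) = E"
    and disj: "disjoint_family_on (orbit G \<phi>) D"
    using D by (auto simp: fundamental_domain_def)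
  have "inj_on (orbit G \<phi>) D"
  proof (rule inj_onI)
    fix x y assume xy: "x \<in> D" "y \<in> D" "orbit G \<phi> x = orbit G \<phi> y"
    then have "x \<in> orbit G \<phi> x \<inter> orbit G \<phi> y" using orbit_refl DE by blast
    then show "x = y" using disj xy by (auto simp: disjoint_family_on_def)
  qed
  moreover have "orbit G \<phi> ` D = orbits G E \<phi>"
  proof
    show "orbit G \<phi> ` D \<subseteq> orbits G E \<phi>" using DE by (auto simp: orbits_def)
    show "orbits G E \<phi> \<subseteq> orbit G \<phi> ` D"
    proof
      fix X assume "X \<in> orbits G E \<phi>"
      then obtain y where y: "y \<in> E" "X = orbit G \<phi> y" by (auto simp: orbits_def)
      then obtain x where x: "x \<in> D" "y \<in> orbit G \<phi> x" using cover by blast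
      have xE: "x \<in> E" using x DE by auto
      have yx: "x \<in> orbit G \<phi> y" by (rule orbit_sym[OF xE y(1) x(2)])
      have sub: "orbit G \<phi> u \<subseteq> E" if "u \<in> E" for u
        using element_image[OF _ that] by (auto simp: orbit_def)
      have "orbit G \<phi> y = orbit G \<phi> x"
        using orbit_trans[OF xE y(1) _ x(2)] orbit_trans[OF y(1) xE _ yx] sub[OF xE] sub[OF y(1)]
        by blast
      then show "X \<in> orbit G \<phi> ` D" using x y by auto
    qed
  qed
  ultimately show ?thesis by (simp add: bij_betw_def)
qed

text \<open>
  The right-hand side does not mention \<open>D\<close>, so the sums over any two fundamental domains agree.
\<close>

lemma sum_fundamental_domain:
  assumes inv: "\<And>g x. \<lbrakk>g \<in> carrier G; x \<in> E\<rbrakk> \<Longrightarrow> f (\<phi> g x) = f x"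
    and D: "fundamental_domain G E \<phi> D"
  shows "sum f D = (\<Sum>X\<in>orbits G E \<phi>. the_elem (f ` X))"
proof -
  have DE: "D \<subseteq> E" using D by (simp add: fundamental_domain_def)
  have "sum f D = (\<Sum>x\<in>D. the_elem (f ` orbit G \<phi> x))"
    using DE invariant_image_orbit[of f, OF inv] by (intro sum.cong) auto
  also have "\<dots> = (\<Sum>X\<in>orbits G E \<phi>. the_elem (f ` X))"
    by (rule sum.reindex_bij_betw[OF fundamental_domain_bij[OF D]])
  finally show ?thesis .
qed

end

lemma packing_number_attained:
  assumes "finite \<Omega>"
  obtains \<C> where "\<C> \<subseteq> \<F>" "disjoint \<C>" "\<And>A. A \<in> \<C> \<Longrightarrow> A \<subseteq> \<Omega>"
    "card \<C> = packing_number \<Omega> \<F>"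
proof -
  let ?N = "{card \<C> | \<C>. \<C> \<subseteq> \<F> \<and> disjoint \<C> \<and> (\<forall>A\<in>\<C>. A \<subseteq> \<Omega>)}"
  have "?N \<subseteq> card ` Pow (Pow \<Omega>)" by auto
  then have "finite ?N" by (rule finite_subset) (use assms in simp)
  moreover have "card ({} :: 'a set set) \<in> ?N" by (intro CollectI exI[of _ "{}"]) auto
  ultimately have "packing_number \<Omega> \<F> \<in> ?N"
    unfolding packing_number_def by (intro Max_in) auto
  then show ?thesis using that by auto
qed

section \<open>Eigenfunctions of an invariant Schroedinger operator\<close>

text \<open>
  The weights are invariant and there are finitely many orbits, so \<open>mV\<close> takes finitely many
  values. This gives the uniform control of point values by the norm on which the analysis below
  rests.
\<close>

locale invariant_schroedinger =
  weighted_graph \<Gamma> arev mV mE + graph_action G \<Gamma> arev \<alpha> \<beta>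
  for \<Gamma> :: "('v, 'e) pre_digraph" and arev :: "'e \<Rightarrow> 'e"
    and mV :: "'v \<Rightarrow> real" and mE :: "'e \<Rightarrow> real"
    and G :: "('g, 'c) monoid_scheme" and \<alpha> :: "'g \<Rightarrow> 'v \<Rightarrow> 'v" and \<beta> :: "'g \<Rightarrow> 'e \<Rightarrow> 'e" +
  fixes q :: "'v \<Rightarrow> real" and lam :: real
  assumes mE_summable: "x \<in> verts \<Gamma> \<Longrightarrow> mE summable_on out_arcs \<Gamma> x"
    and mV_inv: "\<lbrakk>g \<in> carrier G; x \<in> verts \<Gamma>\<rbrakk> \<Longrightarrow> mV (\<alpha> g x) = mV x"
    and mE_inv: "\<lbrakk>g \<in> carrier G; e \<in> arcs \<Gamma>\<rbrakk> \<Longrightarrow> mE (\<beta> g e) = mE e"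
    and q_inv: "\<lbrakk>g \<in> carrier G; x \<in> verts \<Gamma>\<rbrakk> \<Longrightarrow> q (\<alpha> g x) = q x"
    and finite_orbits: "finite (orbits G (verts \<Gamma>) \<alpha>)"
begin

sublocale weighted_l2 "verts \<Gamma>" mV
  by unfold_locales (rule mV_pos)

abbreviation H :: "('v \<Rightarrow> complex) \<Rightarrow> 'v \<Rightarrow> complex" where
  "H \<equiv> schroedinger \<Gamma> mV mE q"

abbreviation eig :: "('v \<Rightarrow> complex) set" where
  "eig \<equiv> eigenspace (verts \<Gamma>) mV H lam"

text \<open>
  If \<open>m > 0\<close> is a lower bound of the vertex weight, \<open>m |\<phi>(x)|\<^sup>2\<close> is at most the squared norm of \<open>\<phi>\<close>, so
  \<open>c = 1 / sqrt m\<close> works.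
\<close>

lemma point_bound:
  obtains c where "0 < c"
    "\<And>\<phi> x. \<phi> \<in> l2 (verts \<Gamma>) mV \<Longrightarrow> cmod (\<phi> x) \<le> c * sqrt (normsq \<phi>)"
proof -
  have fin: "finite (mV ` verts \<Gamma>)"
    by (rule vertex_action.invariant_finite_image[OF mV_inv finite_orbits])
  \<comment> \<open>The element \<open>1\<close> only guards against an empty vertex set.\<close>
  define c where "c = Min (insert 1 (mV ` verts \<Gamma>))"
  have c: "0 < c" "\<And>x. x \<in> verts \<Gamma> \<Longrightarrow> c \<le> mV x"
    using fin mV_pos by (auto simp: c_def)
  have "cmod (\<phi> x) \<le> 1 / sqrt c * sqrt (normsq \<phi>)" if \<phi>: "\<phi> \<in> l2 (verts \<Gamma>) mV" for \<phi> x
  proof (cases "x \<in> verts \<Gamma>")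
    case True
    have "(cmod (\<phi> x))\<^sup>2 * c \<le> (cmod (\<phi> x))\<^sup>2 * mV x"
      using c(2)[OF True] by (intro mult_left_mono) auto
    also have "\<dots> \<le> normsq \<phi>" by (rule point_le_normsq[OF \<phi> True])
    finally have "(cmod (\<phi> x))\<^sup>2 \<le> normsq \<phi> / c" using c(1) by (simp add: field_simps)
    then have "cmod (\<phi> x) \<le> sqrt (normsq \<phi> / c)" by (rule real_le_rsqrt)
    then show ?thesis by (simp add: real_sqrt_divide)
  next
    case False
    then show ?thesis using l2_off[OF \<phi> False] normsq_nonneg[of \<phi>] c(1) by simp
  qed
  then show ?thesis using that[of "1 / sqrt c"] c(1) by simp
qed

lemma neighbour_sum_bound:
  assumes bnd: "\<And>y. cmod (\<phi> y) \<le> M" and x: "x \<in> verts \<Gamma>"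
  shows "(\<lambda>e. \<phi> (head \<Gamma> e) * of_real (mE e)) summable_on out_arcs \<Gamma> x"
    and "cmod (\<Sum>\<^sub>\<infinity>e\<in>out_arcs \<Gamma> x. \<phi> (head \<Gamma> e) * of_real (mE e))
      \<le> M * (\<Sum>\<^sub>\<infinity>e\<in>out_arcs \<Gamma> x. mE e)"
proof -
  have le: "norm (\<phi> (head \<Gamma> e) * of_real (mE e)) \<le> M * mE e" if "e \<in> out_arcs \<Gamma> x" for e
  proof -
    have "0 < mE e" using that by (intro mE_pos) auto
    then show ?thesis using bnd[of "head \<Gamma> e"] by (simp add: norm_mult mult_right_mono)
  qed
  have sM: "(\<lambda>e. M * mE e) summable_on out_arcs \<Gamma> x"
    by (intro summable_on_cmult_right mE_summable x)
  have abs: "(\<lambda>e. norm (\<phi> (head \<Gamma> e) * complex_of_real (mE e))) summable_on out_arcs \<Gamma> x"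
    by (rule abs_summable_on_comparison_test'[OF sM le])
  show "(\<lambda>e. \<phi> (head \<Gamma> e) * of_real (mE e)) summable_on out_arcs \<Gamma> x"
    by (rule abs_summable_summable[OF abs])
  have "cmod (\<Sum>\<^sub>\<infinity>e\<in>out_arcs \<Gamma> x. \<phi> (head \<Gamma> e) * of_real (mE e))
      \<le> (\<Sum>\<^sub>\<infinity>e\<in>out_arcs \<Gamma> x. norm (\<phi> (head \<Gamma> e) * complex_of_real (mE e)))"
    by (rule norm_infsum_bound[OF abs])
  also have "\<dots> \<le> (\<Sum>\<^sub>\<infinity>e\<in>out_arcs \<Gamma> x. M * mE e)"
    by (rule infsum_mono[OF abs sM le])
  also have "\<dots> = M * (\<Sum>\<^sub>\<infinity>e\<in>out_arcs \<Gamma> x. mE e)" by (rule infsum_cmult_right')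
  finally show "cmod (\<Sum>\<^sub>\<infinity>e\<in>out_arcs \<Gamma> x. \<phi> (head \<Gamma> e) * of_real (mE e))
      \<le> M * (\<Sum>\<^sub>\<infinity>e\<in>out_arcs \<Gamma> x. mE e)" .
qed

lemma neighbours_summable:
  assumes "\<phi> \<in> l2 (verts \<Gamma>) mV" "x \<in> verts \<Gamma>"
  shows "(\<lambda>e. \<phi> (head \<Gamma> e) * of_real (mE e)) summable_on out_arcs \<Gamma> x"
proof -
  obtain c where c: "\<And>\<phi> x. \<phi> \<in> l2 (verts \<Gamma>) mV \<Longrightarrow> cmod (\<phi> x) \<le> c * sqrt (normsq \<phi>)"
    using point_bound by blast
  show ?thesis by (rule neighbour_sum_bound(1)[OF c[OF assms(1)] assms(2)])
qed

lemma H_lincomb: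
  assumes "\<phi> \<in> l2 (verts \<Gamma>) mV" "\<psi> \<in> l2 (verts \<Gamma>) mV" "x \<in> verts \<Gamma>"
  shows "H (\<lambda>y. a * \<phi> y + b * \<psi> y) x = a * H \<phi> x + b * H \<psi> x"
proof -
  let ?A = "out_arcs \<Gamma> x"
  have "(\<Sum>\<^sub>\<infinity>e\<in>?A. (a * \<phi> (head \<Gamma> e) + b * \<psi> (head \<Gamma> e)) * complex_of_real (mE e))
      = (\<Sum>\<^sub>\<infinity>e\<in>?A. a * (\<phi> (head \<Gamma> e) * of_real (mE e)) + b * (\<psi> (head \<Gamma> e) * of_real (mE e)))"
    by (intro infsum_cong) (simp add: algebra_simps)
  also have "\<dots> = (\<Sum>\<^sub>\<infinity>e\<in>?A. a * (\<phi> (head \<Gamma> e) * of_real (mE e)))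
      + (\<Sum>\<^sub>\<infinity>e\<in>?A. b * (\<psi> (head \<Gamma> e) * of_real (mE e)))"
    by (intro infsum_add summable_on_cmult_right neighbours_summable assms)
  also have "\<dots> = a * (\<Sum>\<^sub>\<infinity>e\<in>?A. \<phi> (head \<Gamma> e) * of_real (mE e))
      + b * (\<Sum>\<^sub>\<infinity>e\<in>?A. \<psi> (head \<Gamma> e) * of_real (mE e))"
    by (simp only: infsum_cmult_right')
  finally show ?thesis using assms(3) 
    by (simp add: schroedinger_def laplacian_def algebra_simps add_divide_distrib)
qed

text \<open>
  For a fixed vertex the eigenvalue equation is a continuous linear condition on the function, so
  the eigenspace, the intersection of these conditions, is closed.
\<close>

lemma H_pointwise_bounded:
  assumes x: "x \<in> verts \<Gamma>"
  obtains C where "\<And>\<phi>. \<phi> \<in> l2 (verts \<Gamma>) mV \<Longrightarrow> cmod (H \<phi> x - of_real lam * \<phi> x) \<le> C * sqrt (normsq \<phi>)"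
proof -
  obtain c where c: "\<And>\<phi> x. \<phi> \<in> l2 (verts \<Gamma>) mV \<Longrightarrow> cmod (\<phi> x) \<le> c * sqrt (normsq \<phi>)"
    using point_bound by blast
  let ?d = "\<Sum>\<^sub>\<infinity>e\<in>out_arcs \<Gamma> x. mE e"
  let ?p = "complex_of_real (1 / mV x * ?d) + of_real (q x) - of_real lam"
  let ?s = "complex_of_real (1 / mV x)"
  have "cmod (H \<phi> x - of_real lam * \<phi> x) \<le> (cmod ?p * c + cmod ?s * (c * ?d)) * sqrt (normsq \<phi>)"
    if \<phi>: "\<phi> \<in> l2 (verts \<Gamma>) mV" for \<phi>
  proof -
    let ?n = "\<Sum>\<^sub>\<infinity>e\<in>out_arcs \<Gamma> x. \<phi> (head \<Gamma> e) * of_real (mE e)"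
    have "H \<phi> x - of_real lam * \<phi> x = ?p * \<phi> x - ?s * ?n"
      using x by (simp add: schroedinger_def laplacian_def algebra_simps)
    also have "cmod \<dots> \<le> cmod ?p * cmod (\<phi> x) + cmod ?s * cmod ?n"
      by (rule order_trans[OF norm_triangle_ineq4]) (simp only: norm_mult order_refl)
    also have "\<dots> \<le> cmod ?p * (c * sqrt (normsq \<phi>)) + cmod ?s * ((c * sqrt (normsq \<phi>)) * ?d)"
      by (intro add_mono mult_left_mono c \<phi> neighbour_sum_bound(2) x norm_ge_zero)
    finally show ?thesis by (simp add: algebra_simps)
  qed
  then show ?thesis using that by blast
qed

sublocale eig: closed_l2_subspace "verts \<Gamma>" mV eig
proof
  show "f \<in> l2 (verts \<Gamma>) mV" if "f \<in> eig" for f using that by (simp add: eigenspace_def)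
  show "(\<lambda>x. 0) \<in> eig"
    by (simp add: eigenspace_def l2_def schroedinger_def laplacian_def)
  show "(\<lambda>x. a * f x + b * g x) \<in> eig" if "f \<in> eig" "g \<in> eig" for f g a b
    using that l2_lincomb[of f g a b] H_lincomb[of f g _ a b]
    by (simp add: eigenspace_def algebra_simps)
  show "f \<in> eig" if F: "\<And>n. F n \<in> eig" and f: "f \<in> l2 (verts \<Gamma>) mV"
    and lim: "(\<lambda>n. normsq (\<lambda>x. F n x - f x)) \<longlonglongrightarrow> 0" for F f
  proof -
    have "H f x = of_real lam * f x" if x: "x \<in> verts \<Gamma>" for x
    proof -
      obtain C where C: "\<And>\<phi>. \<phi> \<in> l2 (verts \<Gamma>) mV \<Longrightarrow>
          cmod (H \<phi> x - of_real lam * \<phi> x) \<le> C * sqrt (normsq \<phi>)"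
        using H_pointwise_bounded[OF x] by blast
      have "cmod (H f x - of_real lam * f x) \<le> C * sqrt (normsq (\<lambda>x. F n x - f x))" for n
      proof -
        have Fn: "F n \<in> l2 (verts \<Gamma>) mV" "H (F n) x = of_real lam * F n x"
          using F[of n] x by (auto simp: eigenspace_def)
        have "H (\<lambda>x. F n x - f x) x - of_real lam * (F n x - f x) = - (H f x - of_real lam * f x)"
          using H_lincomb[OF Fn(1) f x, of 1 "-1"] Fn(2) by (simp add: algebra_simps)
        then show ?thesis using C[OF l2_diff[OF Fn(1) f]] by (metis norm_minus_cancel)
      qed
      moreover have "(\<lambda>n. C * sqrt (normsq (\<lambda>x. F n x - f x))) \<longlonglongrightarrow> C * sqrt 0"
        by (intro tendsto_intros lim)
      ultimately have "cmod (H f x - of_real lam * f x) \<le> C * sqrt 0"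
        by (intro LIMSEQ_le_const) auto
      then show ?thesis by simp
    qed
    then show ?thesis using f by (simp add: eigenspace_def)
  qed
qed

section \<open>Invariance of the kernels\<close>

text \<open>
  This is the unitary representation at the inverse of \<open>g\<close>; the inverse is left out so that
  only the bijection \<open>\<alpha> g\<close> has to be substituted in sums.
\<close>

definition pull :: "'g \<Rightarrow> ('v \<Rightarrow> complex) \<Rightarrow> 'v \<Rightarrow> complex" where
  "pull g \<phi> = (\<lambda>x. if x \<in> verts \<Gamma> then \<phi> (\<alpha> g x) else 0)"

lemma act_bij: "g \<in> carrier G \<Longrightarrow> bij_betw (\<alpha> g) (verts \<Gamma>) (verts \<Gamma>)"
  using vertex_action.inj_prop vertex_action.surj_prop by (simp add: bij_betw_def)

lemma act_in: "g \<in> carrier G \<Longrightarrow> x \<in> verts \<Gamma> \<Longrightarrow> \<alpha> g x \<in> verts \<Gamma>"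
  using act_bij bij_betwE by blast

lemma out_arcs_bij:
  assumes g: "g \<in> carrier G" and x: "x \<in> verts \<Gamma>"
  shows "bij_betw (\<beta> g) (out_arcs \<Gamma> x) (out_arcs \<Gamma> (\<alpha> g x))"
proof -
  have inj: "inj_on (\<beta> g) (out_arcs \<Gamma> x)"
    using edge_action.inj_prop[OF g] by (rule inj_on_subset) auto
  have "\<beta> g ` out_arcs \<Gamma> x = out_arcs \<Gamma> (\<alpha> g x)"
  proof
    show "\<beta> g ` out_arcs \<Gamma> x \<subseteq> out_arcs \<Gamma> (\<alpha> g x)"
      using edge_action.surj_prop[OF g] tail_act[OF g] by auto
    show "out_arcs \<Gamma> (\<alpha> g x) \<subseteq> \<beta> g ` out_arcs \<Gamma> x"
    proof
      fix e assume e: "e \<in> out_arcs \<Gamma> (\<alpha> g x)"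
      then have "e \<in> \<beta> g ` arcs \<Gamma>" using edge_action.surj_prop[OF g] by simp
      then obtain e' where e': "e' \<in> arcs \<Gamma>" "e = \<beta> g e'" by blast
      then have "\<alpha> g (tail \<Gamma> e') = \<alpha> g x" using e tail_act[OF g] by simp
      then have "tail \<Gamma> e' = x"
        using vertex_action.inj_prop[OF g] e'(1) x tail_in_verts by (auto dest: inj_onD)
      then show "e \<in> \<beta> g ` out_arcs \<Gamma> x" using e' by auto
    qed
  qed
  with inj show ?thesis by (simp add: bij_betw_def)
qed

text \<open>
  The edge action identifies the edges at \<open>x\<close> with those at \<open>g x\<close>, so both sums over edges can be
  reindexed.
\<close>

lemma H_pull:
  assumes g: "g \<in> carrier G" and x: "x \<in> verts \<Gamma>"
  shows "H (pull g \<phi>) x = H \<phi> (\<alpha> g x)"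
proof -
  have deg: "(\<Sum>\<^sub>\<infinity>e\<in>out_arcs \<Gamma> (\<alpha> g x). mE e) = (\<Sum>\<^sub>\<infinity>e\<in>out_arcs \<Gamma> x. mE e)"
    by (subst infsum_reindex_bij_betw[OF out_arcs_bij[OF g x], symmetric])
      (intro infsum_cong, simp add: mE_inv g)
  have nb: "(\<Sum>\<^sub>\<infinity>e\<in>out_arcs \<Gamma> (\<alpha> g x). \<phi> (head \<Gamma> e) * complex_of_real (mE e))
      = (\<Sum>\<^sub>\<infinity>e\<in>out_arcs \<Gamma> x. pull g \<phi> (head \<Gamma> e) * complex_of_real (mE e))"
    by (subst infsum_reindex_bij_betw[OF out_arcs_bij[OF g x], symmetric])
      (intro infsum_cong, simp add: mE_inv head_act g pull_def)
  show ?thesis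
    using x act_in[OF g x]
    by (simp add: schroedinger_def laplacian_def deg nb mV_inv q_inv g pull_def)
qed

lemma ip_pull:
  assumes g: "g \<in> carrier G"
  shows "ip (pull g \<phi>) (pull g \<psi>) = ip \<phi> \<psi>"
  unfolding l2_inner_def
  by (subst (2) infsum_reindex_bij_betw[OF act_bij[OF g], symmetric])
    (intro infsum_cong, simp add: pull_def mV_inv g)

lemma pull_eig:
  assumes g: "g \<in> carrier G" and \<phi>: "\<phi> \<in> eig"
  shows "pull g \<phi> \<in> eig"
proof -
  have "(\<lambda>x. (cmod (\<phi> (\<alpha> g x)))\<^sup>2 * mV (\<alpha> g x)) summable_on verts \<Gamma>"
    using summable_on_reindex_bij_betw[OF act_bij[OF g], of "\<lambda>x. (cmod (\<phi> x))\<^sup>2 * mV x"]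
      l2_summable[of \<phi>] \<phi> by (simp add: eigenspace_def)
  then have "(\<lambda>x. (cmod (pull g \<phi> x))\<^sup>2 * mV x) summable_on verts \<Gamma>"
    by (rule summable_on_cong[THEN iffD1, rotated]) (simp add: pull_def mV_inv g)
  then have "pull g \<phi> \<in> l2 (verts \<Gamma>) mV" by (simp add: l2_def pull_def)
  moreover have "H (pull g \<phi>) x = of_real lam * pull g \<phi> x" if x: "x \<in> verts \<Gamma>" for x
    using H_pull[OF g x] \<phi> x act_in[OF g x] by (simp add: eigenspace_def pull_def)
  ultimately show ?thesis by (simp add: eigenspace_def)
qed

text \<open>
  Pulling back the kernel at \<open>g x\<close> gives an eigenfunction with the reproducing property at \<open>x\<close>,
  hence the kernel at \<open>x\<close>.
\<close>

lemma kernel_invariant: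
  assumes g: "g \<in> carrier G" and x: "x \<in> verts \<Gamma>"
  shows "eig.kernel (\<alpha> g x) (\<alpha> g x) = eig.kernel x x"
proof -
  let ?k = "eig.kernel (\<alpha> g x)"
  interpret grp: group G
    using vertex_action.group_hom by (rule group_hom.axioms(1))
  have g': "inv\<^bsub>G\<^esub> g \<in> carrier G" using g by simp
  have undo: "\<alpha> (inv\<^bsub>G\<^esub> g) (\<alpha> g y) = y" if "y \<in> verts \<Gamma>" for y
    using vertex_action.orbit_sym_aux[OF g that] by simp
  have gx: "\<alpha> g x \<in> verts \<Gamma>" by (rule act_in[OF g x])
  have "eig.kernel x = pull g ?k"
  proof (rule eig.kernel_eqI[OF x])
    show "pull g ?k \<in> eig" by (rule pull_eig[OF g eig.kernel_in[OF gx]])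
    fix h assume h: "h \<in> eig"
    let ?h = "pull (inv\<^bsub>G\<^esub> g) h"
    have "pull g ?h = h"
      using undo act_in[OF g] l2_off[OF eig.S_l2[OF h]] by (auto simp: pull_def fun_eq_iff)
    then have "ip (pull g ?k) h = ip ?k ?h" using ip_pull[OF g, of ?k ?h] by simp
    also have "\<dots> = cnj (?h (\<alpha> g x)) * of_real (mV (\<alpha> g x))"
      by (rule eig.kernel_reproducing[OF gx pull_eig[OF g' h]])
    also have "\<dots> = cnj (h x) * of_real (mV x)"
      using gx undo[OF x] mV_inv[OF g x] by (simp add: pull_def)
    finally show "ip (pull g ?k) h = cnj (h x) * of_real (mV x)" .
  qed
  then show ?thesis using x by (simp add: pull_def)
qed

section \<open>Eigenfunctions vanishing on the thick boundary\<close>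

lemma thick_boundary_by_walk:
  assumes "x \<in> \<Omega>" "awalk x p y" "y \<in> verts \<Gamma> - \<Omega>" "length p \<le> 2"
  shows "x \<in> thick_boundary \<Gamma> 2 \<Omega>"
proof -
  have "(INF y\<in>verts \<Gamma> - \<Omega>. path_dist \<Gamma> x y) \<le> path_dist \<Gamma> x y"
    using assms by (intro INF_lower) auto
  also have "path_dist \<Gamma> x y \<le> enat (length p)"
    unfolding path_dist_def using assms by (intro INF_lower) auto
  also have "\<dots> \<le> enat 2" using assms by simp
  finally show ?thesis using assms(1) by (simp add: thick_boundary_def)
qed

text \<open>
  At a vertex of \<open>\<Omega>\<close> whose neighbours all lie in \<open>\<Omega>\<close>, the cut-off function satisfies the same
  equation as \<open>\<phi>\<close>. At every other vertex it vanishes together with all its neighbours: a vertex of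
  \<open>\<Omega>\<close> with a neighbour outside is in the boundary, and a neighbour in \<open>\<Omega>\<close> of such a vertex, or of a vertex
  outside, has distance at most \<open>2\<close> from the complement.
\<close>

lemma eigenfunction_cutoff:
  assumes \<Omega>: "finite \<Omega>" "\<Omega> \<subseteq> verts \<Gamma>" and \<phi>: "\<phi> \<in> eig"
    and zero: "\<And>b. b \<in> thick_boundary \<Gamma> 2 \<Omega> \<Longrightarrow> \<phi> b = 0"
  shows "(\<lambda>x. if x \<in> \<Omega> then \<phi> x else 0) \<in> eig"
proof -
  define \<psi> where "\<psi> = (\<lambda>x. if x \<in> \<Omega> then \<phi> x else 0)"
  have "\<psi> \<in> l2 (verts \<Gamma>) mV"
    by (rule l2_finite_support[OF \<Omega>(1)]) (use \<Omega>(2) in \<open>auto simp: \<psi>_def\<close>)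
  moreover have "H \<psi> x = of_real lam * \<psi> x" if x: "x \<in> verts \<Gamma>" for x
  proof (cases "x \<in> \<Omega> \<and> (\<forall>e\<in>out_arcs \<Gamma> x. head \<Gamma> e \<in> \<Omega>)")
    case True
    then have "(\<Sum>\<^sub>\<infinity>e\<in>out_arcs \<Gamma> x. \<psi> (head \<Gamma> e) * complex_of_real (mE e))
        = (\<Sum>\<^sub>\<infinity>e\<in>out_arcs \<Gamma> x. \<phi> (head \<Gamma> e) * complex_of_real (mE e))"
      by (intro infsum_cong) (simp add: \<psi>_def)
    then have "H \<psi> x = H \<phi> x"
      using True x by (simp add: schroedinger_def laplacian_def \<psi>_def)
    then show ?thesis using True x \<phi> by (simp add: eigenspace_def \<psi>_def)
  next
    case False
    have "\<psi> x = 0"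
    proof (cases "x \<in> \<Omega>")
      case True
      with False obtain e where e: "e \<in> arcs \<Gamma>" "tail \<Gamma> e = x" "head \<Gamma> e \<notin> \<Omega>" by auto
      have "awalk x [e] (head \<Gamma> e)" using e x by (simp add: awalk_def)
      then have "x \<in> thick_boundary \<Gamma> 2 \<Omega>"
        using e True by (intro thick_boundary_by_walk) auto
      then show ?thesis using zero by (simp add: \<psi>_def)
    qed (simp add: \<psi>_def)
    moreover have "\<psi> (head \<Gamma> e) = 0" if "e \<in> out_arcs \<Gamma> x" for e
    proof (cases "head \<Gamma> e \<in> \<Omega>")
      case True
      have e: "e \<in> arcs \<Gamma>" "tail \<Gamma> e = x" using that by auto
      have "\<exists>p y. awalk (head \<Gamma> e) p y \<and> y \<in> verts \<Gamma> - \<Omega> \<and> length p \<le> 2"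
      proof (cases "x \<in> \<Omega>")
        case True
        with False obtain f where f: "f \<in> arcs \<Gamma>" "tail \<Gamma> f = x" "head \<Gamma> f \<notin> \<Omega>" by auto
        have "awalk (head \<Gamma> e) [arev e, f] (head \<Gamma> f)" using e f by (simp add: awalk_def)
        then show ?thesis using f by (intro exI[of _ "[arev e, f]"] exI[of _ "head \<Gamma> f"]) auto
      next
        case False
        have "awalk (head \<Gamma> e) [arev e] x" using e by (simp add: awalk_def)
        then show ?thesis using False x by (intro exI[of _ "[arev e]"] exI[of _ x]) auto
      qed
      then show ?thesis using zero thick_boundary_by_walk[OF True] by (auto simp: \<psi>_def)
    qed (simp add: \<psi>_def)
    then have "(\<Sum>\<^sub>\<infinity>e\<in>out_arcs \<Gamma> x. \<psi> (head \<Gamma> e) * complex_of_real (mE e)) = 0"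
      by (intro infsum_0) simp
    ultimately show ?thesis by (simp add: schroedinger_def laplacian_def)
  qed
  ultimately show ?thesis by (simp add: eigenspace_def \<psi>_def)
qed

lemma unique_from_boundary:
  assumes \<Omega>: "finite \<Omega>" "\<Omega> \<subseteq> verts \<Gamma>" and unique: "lambda_unique (verts \<Gamma>) mV H lam \<Omega>"
    and \<phi>: "\<phi> \<in> eig" and zero: "\<And>b. b \<in> thick_boundary \<Gamma> 2 \<Omega> \<Longrightarrow> \<phi> b = 0" and x: "x \<in> \<Omega>"
  shows "\<phi> x = 0"
proof -
  define \<psi> where "\<psi> = (\<lambda>x. if x \<in> \<Omega> then \<phi> x else 0)"
  have "\<psi> \<in> eig" unfolding \<psi>_def by (rule eigenfunction_cutoff[OF \<Omega> \<phi> zero])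
  moreover have "\<forall>y\<in>verts \<Gamma> - \<Omega>. \<psi> y = 0" by (simp add: \<psi>_def)
  ultimately have "\<psi> x = 0"
    using unique x \<Omega>(2) unfolding lambda_unique_def eigenspace_def by blast
  then show ?thesis using x by (simp add: \<psi>_def)
qed

section \<open>The trace and the packing number\<close>

lemma trace_on_eig:
  assumes "fundamental_domain G (verts \<Gamma>) \<alpha> D"
  shows "trace_on (verts \<Gamma>) mV D (orth_proj (verts \<Gamma>) mV eig) = (\<Sum>x\<in>D. Re (eig.kernel x x))"
proof -
  have D: "D \<subseteq> verts \<Gamma>" using assms by (simp add: fundamental_domain_def)
  have "finite D"
    using vertex_action.fundamental_domain_bij[OF assms] finite_orbits bij_betw_finite by blast
  moreover have "trace_on (verts \<Gamma>) mV D (orth_proj (verts \<Gamma>) mV eig)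
      = (\<Sum>\<^sub>\<infinity>x\<in>D. Re (eig.kernel x x))"
    unfolding trace_on_def using D by (intro infsum_cong eig.kernel_diagonal) auto
  ultimately show ?thesis by simp
qed

text \<open>
  Each member of a packing carries the whole trace, and by nonnegativity of the diagonal values
  the members together carry at most the sum over \<open>\<Omega>\<close>.
\<close>

lemma packing_times_trace_le:
  assumes \<Omega>: "finite \<Omega>" "\<Omega> \<subseteq> verts \<Gamma>" and unique: "lambda_unique (verts \<Gamma>) mV H lam \<Omega>"
    and D: "fundamental_domain G (verts \<Gamma>) \<alpha> D"
  shows "packing_number \<Omega> {F. fundamental_domain G (verts \<Gamma>) \<alpha> F}
      * trace_on (verts \<Gamma>) mV D (orth_proj (verts \<Gamma>) mV eig)
    \<le> card (thick_boundary \<Gamma> 2 \<Omega>)"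
proof -
  let ?K = "\<lambda>x. Re (eig.kernel x x)"
  let ?t = "trace_on (verts \<Gamma>) mV D (orth_proj (verts \<Gamma>) mV eig)"
  obtain \<C> where \<C>: "\<C> \<subseteq> {F. fundamental_domain G (verts \<Gamma>) \<alpha> F}" "disjoint \<C>"
    "\<And>A. A \<in> \<C> \<Longrightarrow> A \<subseteq> \<Omega>"
    "card \<C> = packing_number \<Omega> {F. fundamental_domain G (verts \<Gamma>) \<alpha> F}"
    using packing_number_attained[OF \<Omega>(1)] by metis
  have inv: "?K (\<alpha> g x) = ?K x" if "g \<in> carrier G" "x \<in> verts \<Gamma>" for g x
    using kernel_invariant[OF that] by simp
  have "sum ?K A = ?t" if "A \<in> \<C>" for A
    using that \<C>(1) vertex_action.sum_fundamental_domain[OF inv] D trace_on_eig[OF D] by auto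
  then have "card \<C> * ?t = (\<Sum>A\<in>\<C>. sum ?K A)" by simp
  also have "\<dots> = sum ?K (\<Union>\<C>)"
  proof -
    have "\<forall>A\<in>\<C>. finite A" using \<C>(3) \<Omega>(1) finite_subset by blast
    moreover have "\<forall>A\<in>\<C>. \<forall>B\<in>\<C>. A \<noteq> B \<longrightarrow> A \<inter> B = {}"
      using \<C>(2) by (auto simp: disjoint_def)
    ultimately have "sum ?K (\<Union>\<C>) = (sum \<circ> sum) ?K \<C>" by (rule sum.Union_disjoint)
    then show ?thesis by simp
  qed
  also have "\<dots> \<le> sum ?K \<Omega>"
    using \<C>(3) \<Omega> eig.kernel_diagonal_nonneg by (intro sum_mono2) auto
  also have "\<dots> \<le> card (thick_boundary \<Gamma> 2 \<Omega>)"
    using unique_from_boundary[OF \<Omega> unique]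
    by (intro eig.local_trace_le_card \<Omega>) (auto simp: thick_boundary_def)
  finally show ?thesis using \<C>(4) by simp
qed

end

theorem theorem6p4:
  fixes \<Gamma> :: "('v, 'e) pre_digraph" and arev :: "'e \<Rightarrow> 'e"
    and mV :: "'v \<Rightarrow> real" and mE :: "'e \<Rightarrow> real" and q :: "'v \<Rightarrow> real"
    and G :: "('g, 'c) monoid_scheme"
    and \<alpha> :: "'g \<Rightarrow> 'v \<Rightarrow> 'v" and \<beta> :: "'g \<Rightarrow> 'e \<Rightarrow> 'e"
    and \<Omega> D :: "'v set" and lam :: real
  defines "V \<equiv> verts \<Gamma>"
    and "H \<equiv> schroedinger \<Gamma> mV mE q"
    and "\<F> \<equiv> {F. fundamental_domain G (verts \<Gamma>) \<alpha> F}"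
  assumes "weighted_graph \<Gamma> arev mV mE"
    and "strongly_connected \<Gamma>"
    and "sunada_sy \<Gamma> mV mE"
    and "graph_action G \<Gamma> arev \<alpha> \<beta>"
    and "\<And>g x. \<lbrakk>g \<in> carrier G; x \<in> V\<rbrakk> \<Longrightarrow> mV (\<alpha> g x) = mV x"
    and "\<And>g e. \<lbrakk>g \<in> carrier G; e \<in> arcs \<Gamma>\<rbrakk> \<Longrightarrow> mE (\<beta> g e) = mE e"
    and "bounded (q ` V)"
    and "\<And>g x. \<lbrakk>g \<in> carrier G; x \<in> V\<rbrakk> \<Longrightarrow> q (\<alpha> g x) = q x"
    and "finite (orbits G V \<alpha>)"
    and "\<Omega> \<subseteq> V" and "finite \<Omega>"
    and "packing_number \<Omega> \<F> \<noteq> 0"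
    and "fundamental_domain G V \<alpha> D"
    and "lambda_unique V mV H lam \<Omega>"
  shows "trace_on V mV D (spectral_proj V mV H lam)
           \<le> real (card (thick_boundary \<Gamma> 2 \<Omega>)) / real (packing_number \<Omega> \<F>)"
proof -
  interpret weighted_graph \<Gamma> arev mV mE by fact
  interpret graph_action G \<Gamma> arev \<alpha> \<beta> by fact
  interpret invariant_schroedinger \<Gamma> arev mV mE G \<alpha> \<beta> q lam
    by unfold_locales (use assms in \<open>auto simp: sunada_sy_def V_def\<close>)
  have "packing_number \<Omega> \<F> * trace_on V mV D (spectral_proj V mV H lam)
      \<le> card (thick_boundary \<Gamma> 2 \<Omega>)"
    unfolding V_def H_def \<F>_def
    by (rule packing_times_trace_le) (use assms in \<open>auto simp: V_def H_def\<close>)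
  then show ?thesis using assms(15) by (simp add: field_simps)
qed

end
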